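(* Let $\widehat{\mathbf a}\in A$ be a fixed point of $T_{\mathrm{AP}}=P_AP_B$ and suppose that $P_B(\widehat{\mathbf a})=\{\widehat{\mathbf b}\}$ is a singleton, $\widehat{\mathbf b}=(\hat x_1,\hat x_2,\ldots,\hat x_m)$, where for every $d=1,\ldots,m$ the matrix $\mathcal G_d(\hat x_d)$ is nonzero in every entry. Let $\varepsilon>0$, and let $U_\varepsilon(\widehat{\mathbf b})$ be a neighborhood of $\widehat{\mathbf b}$ in $\mathcal H^m$ on which $T_{\mathrm{AP}}$ is almost averaged with violation $\varepsilon$ and averaging constant $\alpha=2/3$. Suppose further that (1) $\widehat{\mathbf a}\in U_\varepsilon(\widehat{\mathbf b})$; (2) $T_{\mathrm{AP}}\big(A\cap U_\varepsilon(\widehat{\mathbf b})\big)\subset U_\varepsilon(\widehat{\mathbf b})$; (3) the mapping $\Theta=\mathrm{Id}-T_{\mathrm{AP}}$ is metrically subregular on $U_\varepsilon(\widehat{\mathbf b})$ for $0$ relative to $A$ with modulus $\kappa>\sqrt{2\varepsilon}$. Then every iterative sequence $u_{k+1}\in T_{\mathrm{AP}}(u_k)$ with initial point $u_0\in A\cap U_\varepsilon(\widehat{\mathbf b})$ converges linearly to a point of $\mathrm{Fix}\,T_{\mathrm{AP}}$ with rate at most $c=\sqrt{1+\varepsilon-\kappa^2/2}<1$.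
   Context: Arrays. Let $n,m\ge 1$ be integers. Indices of $n\times n$ arrays are $\xi=(\xi_1,\xi_2)$, $1\le\xi_1,\xi_2\le n$, and $w[\xi]$ is the corresponding entry. Products, absolute values, squares, square roots, exponentials and equalities of arrays are understood elementwise; $\mathrm j=\sqrt{-1}$. Let $\mathcal I=\{XX,XY,XZ,YX,YY,YZ\}$ and $\mathcal H=(\mathbb C^{n\times n})^6$, with elements $x=(x_c)_{c\in\mathcal I}$, with the Frobenius norm $\|x\|^2=\sum_{c\in\mathcal I}\sum_\xi|x_c[\xi]|^2$; product spaces $\mathcal H^m$ carry the norm $\|(w_1,\dots,w_m)\|^2=\sum_d\|w_d\|^2$. The matrices $E_c$. For every index $\xi$ (sampling point of the lens aperture) let $(k_X,k_Y,k_Z)=(k_X[\xi],k_Y[\xi],k_Z[\xi])\in\mathbb R^3$ be a unit vector (the unit wave vector) with $1+k_Z\neq0$. The real $n\times n$ matrices $E_c$, $c\in\mathcal I$, are given entrywise by $E_{XX}=1-\frac{k_X^2}{1+k_Z}$, $E_{XY}=E_{YX}=-\frac{k_Xk_Y}{1+k_Z}$, $E_{YY}=1-\frac{k_Y^2}{1+k_Z}$, $E_{XZ}=-k_X$, $E_{YZ}=-k_Y$; they satisfy $\sum_{c\in\mathcal I}E_c^2=2$ in every entry. Sets. $\mathcal F$ is the (unitary) two-dimensional discrete Fourier transform on $\mathbb C^{n\times n}$. For $d=1,\dots,m$ let $\phi_d\in\mathbb R^{n\times n}$ (phase diversity) and $r_d\in\mathbb R_+^{n\times n}$ (entrywise nonnegative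 measured intensity). Define $\Omega_0=\{(E_c\cdot x)_{c\in\mathcal I}\in\mathcal H: x\in\mathbb C^{n\times n}\}$, $\Omega_d=\{(x_c)_{c\in\mathcal I}\in\mathcal H:\sum_{c\in\mathcal I}|\mathcal F(x_c\cdot e^{\mathrm j\phi_d})|^2\text{-type constraint}\}$, precisely: $\Omega_d$ is the set of $x\in\mathcal H$ with $\sum_{c\in\mathcal I}|M_d(x)_c|^2=r_d$, where $M_d(x)=(\mathcal F(x_c\cdot e^{\mathrm j\phi_d}))_{c\in\mathcal I}$. Put $\mathcal G_d(x)=\sqrt{\sum_{c\in\mathcal I}|M_d(x)_c|^2}\in\mathbb R_+^{n\times n}$. Further $A=\{(x,x,\dots,x)\in\mathcal H^m: x\in\Omega_0\}$ and $B=\Omega_1\times\Omega_2\times\cdots\times\Omega_m\subset\mathcal H^m$ ($A\cap B$ may be empty). Projectors and operators. For a subset $\Omega$ of a finite-dimensional Hilbert space, $\mathrm{dist}(x,\Omega)=\inf_{w\in\Omega}\|x-w\|$ and $P_\Omega(x)=\{w\in\Omega:\|x-w\|=\mathrm{dist}(x,\Omega)\}$ (set-valued). $T_{\mathrm{AP}}=P_AP_B:\mathcal H^m\rightrightarrows\mathcal H^m$, i.e. $T_{\mathrm{AP}}(u)=\bigcup_{b\in P_B(u)}P_A(b)$. For a set-valued self-map $T$, $\mathrm{Fix}\,T=\{x: x\in T(x)\}$; $\mathrm{Id}$ is the identity. Almost averagedness. $T$ is pointwise almost averaged at $y$ on a set $U$ with violation $\varepsilon\ge0$ and averaging constant $\alpha\in(0,1)$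 if for all $y^+\in T(y)$, $z\in U$, $z^+\in T(z)$: $\|z^+-y^+\|^2\le(1+\varepsilon)\|z-y\|^2-\frac{1-\alpha}{\alpha}\|(z^+-z)-(y^+-y)\|^2$. It is almost averaged on $U$ (with violation $\varepsilon$ and averaging constant $\alpha$) if this holds at every $y\in U$ with the same $\varepsilon,\alpha$. Metric subregularity. A set-valued map $\Theta$ is metrically subregular on $U$ for $\hat y$ relative to $\Lambda$ with modulus $\kappa>0$ if $\kappa\,\mathrm{dist}(x,\Theta^{-1}(\hat y)\cap\Lambda)\le\mathrm{dist}(\hat y,\Theta(x))$ for all $x\in U\cap\Lambda$. Linear convergence. A sequence $(u_k)$ converges linearly to $u$ with rate $c\in(0,1)$ if there is $\gamma>0$ with $\|u_k-u\|\le\gamma c^k$ for all $k\in\mathbb N$. *)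

theory Defs
  imports "HOL-Analysis.Analysis"
begin

datatype comp = XX | XY | XZ | YX | YY | YZ

lemma UNIV_comp: "(UNIV :: comp set) = {XX, XY, XZ, YX, YY, YZ}"
  by (auto intro: comp.exhaust)

instance comp :: finite
  by standard (simp add: UNIV_comp)

text \<open>
  The integers n and m are the cardinalities of the index types \<open>'n\<close> and \<open>'m\<close>. The type \<open>'n\<close> carries
  a linear order because the discrete Fourier transform needs the position of an index.
  The library norm on iterated \<open>vec\<close> types is the Frobenius norm.
\<close>

type_synonym 'n rarray = "((real, 'n) vec, 'n) vec"
type_synonym 'n carray = "((complex, 'n) vec, 'n) vec"
type_synonym 'n hspace = "('n carray, comp) vec"
type_synonym ('n, 'm) hprod = "('n hspace, 'm) vec"


subsection \<open>The physical model\<close>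

text \<open>Zero-based position: the element playing the role of the index \<open>i\<close> in 1, ..., n has position
  \<open>i - 1\<close>.\<close>

definition pos :: "'n::{finite,linorder} \<Rightarrow> nat" where
  "pos i = card {j. j < i}"

definition dft2 :: "'n::{finite,linorder} carray \<Rightarrow> 'n carray" where
  "dft2 w = (\<chi> p q. (1 / of_nat CARD('n)) *
     (\<Sum>i\<in>UNIV. \<Sum>j\<in>UNIV. w $ i $ j *
        exp (- (2 * of_real pi * \<i> * of_nat (pos i * pos p + pos j * pos q) / of_nat CARD('n)))))"

definition Emat :: "'n::{finite,linorder} rarray \<Rightarrow> 'n rarray \<Rightarrow> 'n rarray \<Rightarrow> comp \<Rightarrow> 'n rarray" where
  "Emat kX kY kZ c = (\<chi> i j. case c of
       XX \<Rightarrow> 1 - (kX $ i $ j)\<^sup>2 / (1 + kZ $ i $ j)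
     | XY \<Rightarrow> - (kX $ i $ j * kY $ i $ j) / (1 + kZ $ i $ j)
     | XZ \<Rightarrow> - kX $ i $ j
     | YX \<Rightarrow> - (kX $ i $ j * kY $ i $ j) / (1 + kZ $ i $ j)
     | YY \<Rightarrow> 1 - (kY $ i $ j)\<^sup>2 / (1 + kZ $ i $ j)
     | YZ \<Rightarrow> - kY $ i $ j)"

definition Omega0 ::
    "'n::{finite,linorder} rarray \<Rightarrow> 'n rarray \<Rightarrow> 'n rarray \<Rightarrow> 'n hspace set" where
  "Omega0 kX kY kZ =
     {(\<chi> c. \<chi> i j. of_real (Emat kX kY kZ c $ i $ j) * x $ i $ j) | x. x \<in> UNIV}"

definition Mmap :: "'n::{finite,linorder} rarray \<Rightarrow> 'n hspace \<Rightarrow> 'n hspace" where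
  "Mmap \<phi> x = (\<chi> c. dft2 (\<chi> i j. x $ c $ i $ j * exp (\<i> * of_real (\<phi> $ i $ j))))"

definition Omega ::
    "'n::{finite,linorder} rarray \<Rightarrow> 'n rarray \<Rightarrow> 'n hspace set" where
  "Omega \<phi> r = {x. \<forall>i j. (\<Sum>c\<in>UNIV. (cmod (Mmap \<phi> x $ c $ i $ j))\<^sup>2) = r $ i $ j}"

definition Gmap :: "'n::{finite,linorder} rarray \<Rightarrow> 'n hspace \<Rightarrow> 'n rarray" where
  "Gmap \<phi> x = (\<chi> i j. sqrt (\<Sum>c\<in>UNIV. (cmod (Mmap \<phi> x $ c $ i $ j))\<^sup>2))"

definition setA ::
    "'n::{finite,linorder} rarray \<Rightarrow> 'n rarray \<Rightarrow> 'n rarray \<Rightarrow> ('n, 'm::finite) hprod set" where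
  "setA kX kY kZ = {(\<chi> d. x) | x. x \<in> Omega0 kX kY kZ}"

definition setB ::
    "('m::finite \<Rightarrow> 'n::{finite,linorder} rarray) \<Rightarrow> ('m \<Rightarrow> 'n rarray) \<Rightarrow> ('n, 'm) hprod set" where
  "setB \<phi> r = {w. \<forall>d. w $ d \<in> Omega (\<phi> d) (r d)}"


subsection \<open>Set-valued mappings\<close>

text \<open>A set-valued self-map of \<open>'a\<close> is a function of type \<open>'a \<Rightarrow> 'a set\<close>.\<close>

definition proj :: "'a::real_normed_vector set \<Rightarrow> 'a \<Rightarrow> 'a set" where
  "proj S x = {w \<in> S. norm (x - w) = infdist x S}"

definition T_AP :: "'a::real_normed_vector set \<Rightarrow> 'a set \<Rightarrow> 'a \<Rightarrow> 'a set" where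
  "T_AP A B u = (\<Union>b\<in>proj B u. proj A b)"

definition Fix :: "('a \<Rightarrow> 'a set) \<Rightarrow> 'a set" where
  "Fix T = {x. x \<in> T x}"

definition id_minus :: "('a::real_normed_vector \<Rightarrow> 'a set) \<Rightarrow> 'a \<Rightarrow> 'a set" where
  "id_minus T x = {x - v | v. v \<in> T x}"

definition pointwise_almost_averaged ::
    "('a::real_normed_vector \<Rightarrow> 'a set) \<Rightarrow> 'a \<Rightarrow> 'a set \<Rightarrow> real \<Rightarrow> real \<Rightarrow> bool" where
  "pointwise_almost_averaged T y U \<epsilon> \<alpha> \<longleftrightarrow> 0 \<le> \<epsilon> \<and> 0 < \<alpha> \<and> \<alpha> < 1 \<and>
     (\<forall>y' \<in> T y. \<forall>z \<in> U. \<forall>z' \<in> T z.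
        (norm (z' - y'))\<^sup>2 \<le> (1 + \<epsilon>) * (norm (z - y))\<^sup>2
           - (1 - \<alpha>) / \<alpha> * (norm ((z' - z) - (y' - y)))\<^sup>2)"

definition almost_averaged ::
    "('a::real_normed_vector \<Rightarrow> 'a set) \<Rightarrow> 'a set \<Rightarrow> real \<Rightarrow> real \<Rightarrow> bool" where
  "almost_averaged T U \<epsilon> \<alpha> \<longleftrightarrow> (\<forall>y \<in> U. pointwise_almost_averaged T y U \<epsilon> \<alpha>)"

text \<open>
  \<open>infdist\<close> to the empty set is 0, not infinity. For the alternating projection mapping onto the
  sets \<open>setA\<close> and \<open>setB\<close> (closed, nonempty when the intensities are nonnegative) with a fixed point
  in \<open>setA\<close>, all sets below are nonempty, so this convention is immaterial there.
\<close>

definition metrically_subregular ::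
    "('a::real_normed_vector \<Rightarrow> 'b::real_normed_vector set) \<Rightarrow> 'a set \<Rightarrow> 'b \<Rightarrow> 'a set \<Rightarrow> real \<Rightarrow> bool" where
  "metrically_subregular \<Theta> U y \<Lambda> \<kappa> \<longleftrightarrow> 0 < \<kappa> \<and>
     (\<forall>x \<in> U \<inter> \<Lambda>. \<kappa> * infdist x ({v. y \<in> \<Theta> v} \<inter> \<Lambda>) \<le> infdist y (\<Theta> x))"

definition converges_linearly :: "(nat \<Rightarrow> 'a::real_normed_vector) \<Rightarrow> 'a \<Rightarrow> real \<Rightarrow> bool" where
  "converges_linearly u p c \<longleftrightarrow> 0 < c \<and> c < 1 \<and> (\<exists>\<gamma>>0. \<forall>k. norm (u k - p) \<le> \<gamma> * c ^ k)"

text \<open>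
  A rate is a number in (0,1), and larger numbers in (0,1) are rates as well. For \<open>c\<close> in (0,1)
  the following is convergence with rate \<open>c\<close>. The bound \<open>sqrt (1 + \<epsilon> - \<kappa>\<^sup>2 / 2)\<close> is not positive
  if \<open>\<kappa>\<^sup>2 \<ge> 2 * (1 + \<epsilon>)\<close> (\<open>sqrt\<close> is odd on the reals), which the hypotheses on \<open>\<kappa>\<close> do not exclude;
  then every number in (0,1) has to be a rate.
\<close>

definition converges_linearly_at_most :: "(nat \<Rightarrow> 'a::real_normed_vector) \<Rightarrow> 'a \<Rightarrow> real \<Rightarrow> bool" where
  "converges_linearly_at_most u p c \<longleftrightarrow>
     (if 0 < c then converges_linearly u p c
      else (\<forall>c'. 0 < c' \<and> c' < 1 \<longrightarrow> converges_linearly u p c'))"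

end

theory Submission
  imports Defs
begin

text \<open>
  The squared distance \<open>f\<close> to \<open>B\<close> is a Lyapunov function for alternating projections between the linear
  subspace \<open>A\<close> and \<open>B\<close>: a step from \<open>x\<close> to \<open>y\<close> lowers \<open>f\<close> by at least \<open>\<bar>x - y\<bar>\<^sup>2\<close>
  (\<open>T_AP_step_decrease\<close>), and \<open>f(x) \<le> f(p) + \<bar>x - p\<bar>\<^sup>2\<close> for every fixed point \<open>p\<close>
  (\<open>infdist_le_at_fixed_point\<close>). Both are instances of the theorem of Pythagoras. Let \<open>d\<close> be the
  distance of the current iterate to the fixed points. Metric subregularity bounds \<open>\<kappa> * d\<close> by the step
  length, so \<open>d\<close> tends to 0. If the nearest fixed points have the value \<open>f' = lim f\<close>, then
  \<open>\<kappa>\<^sup>2 * (f - f') \<le> \<kappa>\<^sup>2 * d\<^sup>2\<close> is at most the decrease of \<open>f\<close>. Thus \<open>f - f'\<close> contracts by the factor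
  \<open>1 - \<kappa>\<^sup>2 \<le> 1 + \<epsilon> - \<kappa>\<^sup>2 / 2\<close>, and the steps, which are bounded by the square root of \<open>f - f'\<close>, decay
  geometrically (\<open>linear_convergence_of_finite_critical_distances\<close>).

  The nearest fixed points may lie outside \<open>U\<close>, and nothing said so far excludes that their values
  approach \<open>f'\<close> without ever reaching it. This is impossible because \<open>f\<close> has only finitely many
  values at fixed points. After unitary Fourier transforms (\<open>norm_dft2\<close>), \<open>B\<close> is a
  product of spheres, one for each pixel of each image (\<open>setB_eq_spheres\<close>). A fixed point is \<open>P b\<close>,
  where \<open>P\<close> is the orthogonal projection on \<open>A\<close> and \<open>b\<close> is a critical point, in the sense of Lagrange
  multipliers, of the quadratic form \<open>b \<bullet> P b\<close> on this product of spheres, and \<open>f\<close> is a constant minus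
  the critical value (\<open>finite_fixed_point_distances\<close>).

  That a quadratic form has finitely many critical values under quadratic constraints
  (\<open>finite_critical_values_of_quadratic_form\<close>) is Sard's theorem for algebraic functions. It has a
  purely algebraic proof: infinitely many critical values would produce a critical point over an
  ultrapower of the reals whose value is transcendental over the reals
  (\<open>germ_transcendental\<close>). Derivations extend along ring extensions in characteristic 0
  (\<open>extend_derivation\<close>), so some derivation over the reals does not vanish at this value. But the
  Lagrange condition makes every derivation over the reals vanish there.
\<close>

section \<open>Extending derivations of subrings\<close>

text \<open>
  A derivation of a subring with values in the ambient field. Letting the values leave the subring
  makes it possible to adjoin elements one at a time without ever passing to fraction fields.
\<close>

locale subring_derivation =
  fixes S :: "'a::field_char_0 set" and D :: "'a \<Rightarrow> 'a"
  assumes one_closed: "1 \<in> S"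
    and add_closed: "a \<in> S \<Longrightarrow> b \<in> S \<Longrightarrow> a + b \<in> S"
    and uminus_closed: "a \<in> S \<Longrightarrow> - a \<in> S"
    and mult_closed: "a \<in> S \<Longrightarrow> b \<in> S \<Longrightarrow> a * b \<in> S"
    and D_add: "a \<in> S \<Longrightarrow> b \<in> S \<Longrightarrow> D (a + b) = D a + D b"
    and D_mult: "a \<in> S \<Longrightarrow> b \<in> S \<Longrightarrow> D (a * b) = D a * b + a * D b"
begin

lemma zero_closed: "0 \<in> S"
  using add_closed[OF one_closed uminus_closed[OF one_closed]] by simp

lemma D_0: "D 0 = 0"
  using D_add[OF zero_closed zero_closed] by simp

lemma D_1: "D 1 = 0"
  using D_mult[OF one_closed one_closed] by simp

lemma sum_closed: "(\<And>i. i \<in> I \<Longrightarrow> f i \<in> S) \<Longrightarrow> sum f I \<in> S"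
  by (induction I rule: infinite_finite_induct) (auto intro: add_closed zero_closed)

lemma D_sum: "(\<And>i. i \<in> I \<Longrightarrow> f i \<in> S) \<Longrightarrow> D (sum f I) = (\<Sum>i\<in>I. D (f i))"
  by (induction I rule: infinite_finite_induct) (auto simp: D_add D_0 sum_closed)

definition polys :: "'a poly set" where
  "polys = {p. \<forall>i. coeff p i \<in> S}"

lemma polys_const: "a \<in> S \<Longrightarrow> [:a:] \<in> polys"
  by (auto simp: polys_def coeff_pCons zero_closed split: nat.split)

lemma polys_add: "p \<in> polys \<Longrightarrow> q \<in> polys \<Longrightarrow> p + q \<in> polys"
  by (auto simp: polys_def add_closed)

lemma polys_uminus: "p \<in> polys \<Longrightarrow> - p \<in> polys"
  by (auto simp: polys_def uminus_closed)

lemma polys_diff: "p \<in> polys \<Longrightarrow> q \<in> polys \<Longrightarrow> p - q \<in> polys"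
  using polys_add[OF _ polys_uminus] by fastforce

lemma polys_mult: "p \<in> polys \<Longrightarrow> q \<in> polys \<Longrightarrow> p * q \<in> polys"
  by (auto simp: polys_def coeff_mult intro!: sum_closed mult_closed)

lemma polys_monom: "a \<in> S \<Longrightarrow> monom a n \<in> polys"
  by (auto simp: polys_def zero_closed)

lemma of_nat_closed: "of_nat n \<in> S"
  by (induction n) (auto intro: zero_closed one_closed add_closed)

lemma polys_pderiv: "p \<in> polys \<Longrightarrow> pderiv p \<in> polys"
  unfolding polys_def coeff_pderiv mem_Collect_eq
  by (intro allI mult_closed of_nat_closed) blast

lemma map_poly_D_add: "p \<in> polys \<Longrightarrow> q \<in> polys \<Longrightarrow> map_poly D (p + q) = map_poly D p + map_poly D q"
  by (rule poly_eqI) (auto simp: coeff_map_poly D_0 D_add polys_def)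

lemma map_poly_D_mult:
  assumes "p \<in> polys" "q \<in> polys"
  shows "map_poly D (p * q) = map_poly D p * q + p * map_poly D q"
proof (rule poly_eqI)
  fix n
  have "coeff (map_poly D (p * q)) n = D (\<Sum>i\<le>n. coeff p i * coeff q (n - i))"
    by (simp add: coeff_map_poly D_0 coeff_mult)
  also have "\<dots> = (\<Sum>i\<le>n. D (coeff p i * coeff q (n - i)))"
    using assms by (intro D_sum) (auto simp: polys_def intro: mult_closed)
  also have "\<dots> = coeff (map_poly D p * q + p * map_poly D q) n"
    using assms by (simp add: coeff_mult coeff_map_poly D_0 D_mult polys_def sum.distrib)
  finally show "coeff (map_poly D (p * q)) n = coeff (map_poly D p * q + p * map_poly D q) n" .
qed

text \<open>Forced value at \<open>p(x)\<close> of an extension of \<open>D\<close> that sends \<open>x\<close> to \<open>w\<close>.\<close>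

definition chain_rule :: "'a \<Rightarrow> 'a \<Rightarrow> 'a poly \<Rightarrow> 'a" where
  "chain_rule x w p = poly (map_poly D p) x + poly (pderiv p) x * w"

lemma chain_rule_add:
  "p \<in> polys \<Longrightarrow> q \<in> polys \<Longrightarrow> chain_rule x w (p + q) = chain_rule x w p + chain_rule x w q"
  by (simp add: chain_rule_def map_poly_D_add pderiv_add algebra_simps)

lemma chain_rule_0: "chain_rule x w 0 = 0"
  by (simp add: chain_rule_def)

lemma chain_rule_diff:
  assumes "p \<in> polys" "q \<in> polys" 
  shows "chain_rule x w (p - q) = chain_rule x w p - chain_rule x w q"
  using chain_rule_add[OF polys_diff[OF assms] assms(2), of x w] by simp

lemma chain_rule_mult:
  assumes "p \<in> polys" "q \<in> polys"
  shows "chain_rule x w (p * q) = chain_rule x w p * poly q x + poly p x * chain_rule x w q"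
  using assms by (simp add: chain_rule_def map_poly_D_mult pderiv_mult algebra_simps)

definition transcendental :: "'a \<Rightarrow> bool" where
  "transcendental x \<longleftrightarrow> (\<forall>p\<in>polys. poly p x = 0 \<longrightarrow> p = 0)"

text \<open>
  An extension of the derivation to \<open>S[x]\<close> with \<open>x \<mapsto> w\<close> must send \<open>p(x)\<close> to
  \<open>chain_rule x w p\<close>, so it exists iff every polynomial relation of \<open>x\<close> is respected. A transcendental
  \<open>x\<close> has no relation. For an algebraic \<open>x\<close> a relation \<open>g\<close> of least degree determines \<open>w\<close>: in
  characteristic 0 the derivative \<open>g'\<close> is nonzero of smaller degree, so \<open>g'(x) \<noteq> 0\<close>. The other
  relations follow by pseudo-division by \<open>g\<close>.
\<close>

lemma ex_consistent_value:
  "\<exists>w. (transcendental x \<longrightarrow> w = 1) \<and> (\<forall>p\<in>polys. poly p x = 0 \<longrightarrow> chain_rule x w p = 0)"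
proof (cases "transcendental x")
  case True
  then show ?thesis by (auto simp: transcendental_def chain_rule_0)
next
  case False
  define g where "g = (ARG_MIN degree p. p \<in> polys \<and> p \<noteq> 0 \<and> poly p x = 0)"
  obtain p0 where p0: "p0 \<in> polys \<and> p0 \<noteq> 0 \<and> poly p0 x = 0"
    using False by (auto simp: transcendental_def)
  have g: "g \<in> polys" "g \<noteq> 0" "poly g x = 0"
    using arg_min_natI[of "\<lambda>p. p \<in> polys \<and> p \<noteq> 0 \<and> poly p x = 0", OF p0, of degree]
    by (auto simp: g_def)
  have min: "degree g \<le> degree p" if "p \<in> polys" "p \<noteq> 0" "poly p x = 0" for p
    using arg_min_nat_le[of "\<lambda>p. p \<in> polys \<and> p \<noteq> 0 \<and> poly p x = 0" p degree] that
    by (auto simp: g_def)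
  have deg: "degree g \<noteq> 0"
  proof
    assume "degree g = 0"
    then obtain c where "g = [:c:]" by (rule degree_eq_zeroE)
    then show False using g by simp
  qed
  have g': "poly (pderiv g) x \<noteq> 0"
  proof
    assume "poly (pderiv g) x = 0"
    moreover have "pderiv g \<noteq> 0" using deg by (simp add: pderiv_eq_0_iff)
    ultimately have "degree g \<le> degree (pderiv g)" using min polys_pderiv g by blast
    then show False using deg by (simp add: degree_pderiv)
  qed
  define w where "w = - poly (map_poly D g) x / poly (pderiv g) x"
  have wg: "chain_rule x w g = 0"
    using g' by (simp add: chain_rule_def w_def)
  have "chain_rule x w p = 0" if "p \<in> polys" "poly p x = 0" for p
    using that
  proof (induction "degree p" arbitrary: p rule: less_induct)
    case less
    show ?case
    proof (cases "p = 0")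
      case True
      then show ?thesis by (simp add: chain_rule_0)
    next
      case False
      define k where "k = degree p - degree g"
      have le: "degree g \<le> degree p" using min less.prems False by blast
      define a where "a = [:lead_coeff g:]"
      define b where "b = monom (lead_coeff p) k"
      have "coeff g i \<in> S" "coeff p i \<in> S" for i
        using g less.prems by (auto simp: polys_def)
      then have ab: "a \<in> polys" "b \<in> polys"
        unfolding a_def b_def by (auto intro: polys_const polys_monom)
      \<comment> \<open>The factor \<open>a\<close> replaces the division by the leading coefficient of \<open>g\<close>, which need not be
        invertible in \<open>S\<close>; it is harmless, since \<open>chain_rule x w (a * p)\<close> is that coefficient times
        \<open>chain_rule x w p\<close> when \<open>p(x) = 0\<close>.\<close>
      define q where "q = a * p - b * g"
      have q: "q \<in> polys" "poly q x = 0"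
        using ab g less.prems by (auto simp: q_def intro!: polys_diff polys_mult)
      have nz: "lead_coeff p \<noteq> 0" "lead_coeff g \<noteq> 0" using False g by auto
      have dq: "q = 0 \<or> degree q < degree p"
      proof -
        have "degree (a * p) = degree p" using nz by (simp add: a_def)
        moreover have "degree (b * g) = degree p"
        proof -
          have "degree b = k" unfolding b_def by (rule degree_monom_eq[OF nz(1)])
          moreover have "b \<noteq> 0" using nz(1) by (simp add: b_def monom_eq_0_iff)
          ultimately show ?thesis using le g(2) by (simp add: k_def degree_mult_eq)
        qed
        moreover have "lead_coeff (a * p) = lead_coeff (b * g)"
          by (simp only: lead_coeff_mult) (simp add: a_def b_def degree_monom_eq[OF nz(1)])
        ultimately have "degree q \<le> degree p" "coeff q (degree p) = 0"
          unfolding q_def by (metis degree_diff_le order_refl, metis coeff_diff right_minus_eq)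
        then show ?thesis by (metis eq_zero_or_degree_less)
      qed
      have "chain_rule x w q = 0"
        using dq less.hyps q by (auto simp: chain_rule_0)
      moreover have "chain_rule x w q = lead_coeff g * chain_rule x w p"
        using ab g less.prems wg
        by (simp add: q_def chain_rule_diff chain_rule_mult polys_mult) (simp add: a_def)
      ultimately show ?thesis using nz by simp
    qed
  qed
  then show ?thesis using False by blast
qed

lemma extend_derivation:
  "\<exists>S' D'. subring_derivation S' D' \<and> S \<subseteq> S' \<and> x \<in> S' \<and> (\<forall>a\<in>S. D' a = D a) \<and>
     (transcendental x \<longrightarrow> D' x = 1)"
proof -
  obtain w where w: "transcendental x \<longrightarrow> w = 1"
    and consistent: "\<And>p. p \<in> polys \<Longrightarrow> poly p x = 0 \<Longrightarrow> chain_rule x w p = 0"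
    using ex_consistent_value by blast
  define S' where "S' = (\<lambda>p. poly p x) ` polys"
  define D' where "D' z = chain_rule x w (SOME p. p \<in> polys \<and> poly p x = z)" for z
  have D': "D' (poly p x) = chain_rule x w p" if "p \<in> polys" for p
  proof -
    define q where "q = (SOME q. q \<in> polys \<and> poly q x = poly p x)"
    have q: "q \<in> polys \<and> poly q x = poly p x"
      unfolding q_def by (rule someI[of _ p]) (use that in simp)
    have "chain_rule x w (q - p) = 0"
      using q that by (intro consistent polys_diff) auto
    then show ?thesis
      using q that by (simp add: D'_def q_def[symmetric] chain_rule_diff)
  qed
  have "subring_derivation S' D'"
  proof
    show "1 \<in> S'"
      unfolding S'_def using polys_const[OF one_closed] by (force intro: image_eqI[of _ _ "[:1:]"])
  next
    fix a b assume "a \<in> S'" "b \<in> S'"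
    then obtain p q where pq: "p \<in> polys" "q \<in> polys" "a = poly p x" "b = poly q x"
      by (auto simp: S'_def)
    show "a + b \<in> S'" "a * b \<in> S'"
      unfolding S'_def pq poly_add[symmetric] poly_mult[symmetric]
      by (rule imageI, simp add: pq polys_add polys_mult)+
    show "D' (a + b) = D' a + D' b" "D' (a * b) = D' a * b + a * D' b"
      using D'[OF polys_add[OF pq(1,2)]] D'[OF polys_mult[OF pq(1,2)]] D'[OF pq(1)] D'[OF pq(2)] pq
      by (simp_all add: chain_rule_add chain_rule_mult)
  next
    fix a assume "a \<in> S'"
    then obtain p where "p \<in> polys" "a = poly p x" by (auto simp: S'_def)
    then show "- a \<in> S'"
      unfolding S'_def by (metis imageI poly_minus polys_uminus)
  qed
  moreover have "a \<in> S' \<and> D' a = D a" if "a \<in> S" for a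
    using D'[OF polys_const[OF that]] polys_const[OF that]
    by (force simp: S'_def chain_rule_def map_poly_pCons D_0 intro: image_eqI[of _ _ "[:a:]"])
  moreover have "x \<in> S' \<and> D' x = w"
  proof -
    have X: "monom 1 1 \<in> polys" by (rule polys_monom[OF one_closed])
    have "D' (poly (monom 1 1) x) = w"
      unfolding D'[OF X] by (simp add: chain_rule_def map_poly_monom D_0 D_1 pderiv_monom)
    then show ?thesis
      using X by (auto simp: S'_def poly_monom intro!: image_eqI[of _ _ "monom 1 1"])
  qed
  ultimately show ?thesis using w by blast
qed

lemma extend_derivation_finite:
  assumes "finite F"
  shows "\<exists>S' D'. subring_derivation S' D' \<and> S \<subseteq> S' \<and> F \<subseteq> S' \<and> (\<forall>a\<in>S. D' a = D a)"
  using assms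
proof (induction F)
  case empty
  have "subring_derivation S D" ..
  then show ?case by blast
next
  case (insert x F)
  then obtain S' D' where *: "subring_derivation S' D'" "S \<subseteq> S'" "F \<subseteq> S'" "\<forall>a\<in>S. D' a = D a"
    by blast
  interpret ext: subring_derivation S' D' by fact
  from ext.extend_derivation[of x] * show ?case
    by (metis insert_subset subset_trans subsetD)
qed

end

section \<open>A field of germs of real sequences\<close>

text \<open>
  The ultrapower of the reals over a nonprincipal ultrafilter. A sequence of real solutions of
  polynomial equations becomes one solution in a field, and if a coordinate takes pairwise distinct
  values, then this coordinate becomes transcendental over the real constants.
\<close>

text \<open>
  Zorn's lemma gives a minimal proper filter below \<open>sequentially\<close>. Its minimality is applied to its
  restriction to a set \<open>{n. P n}\<close>, which is proper unless the complement of this set is large.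
\<close>

lemma ex_ultrafilter:
  "\<exists>U::nat filter. U \<noteq> bot \<and> U \<le> sequentially \<and> (\<forall>P. eventually P U \<or> eventually (\<lambda>n. \<not> P n) U)"
proof -
  define \<A> where "\<A> = {F::nat filter. F \<noteq> bot \<and> F \<le> sequentially}"
  have "\<exists>U\<in>\<A>. \<forall>F\<in>\<A>. F \<le> U \<longrightarrow> F = U"
  proof (rule predicate_Zorn[where P = "\<lambda>F G. G \<le> F"])
    show "partial_order_on \<A> (relation_of (\<lambda>F G. G \<le> F) \<A>)"
      by (rule partial_order_on_relation_ofI) auto
  next
    fix C assume C: "C \<in> Chains (relation_of (\<lambda>F G. G \<le> F) \<A>)"
    have sub: "C \<subseteq> \<A>" and chain: "\<And>F G. F \<in> C \<Longrightarrow> G \<in> C \<Longrightarrow> F \<le> G \<or> G \<le> F"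
      using C by (auto simp: Chains_def relation_of_def)
    show "\<exists>F\<in>\<A>. \<forall>G\<in>C. F \<le> G"
    proof (cases "C = {}")
      case True
      then show ?thesis by (auto simp: \<A>_def intro!: exI[of _ sequentially])
    next
      case False
      have fin: "Inf X \<in> C" if "finite X" "X \<noteq> {}" "X \<subseteq> C" for X
        using that
      proof (induction X rule: finite_ne_induct)
        case (insert F X)
        then show ?case using chain[of F "Inf X"] by (auto simp: inf_absorb1 inf_absorb2)
      qed auto
      have "Inf X \<noteq> bot" if "X \<subseteq> C" "finite X" for X
        using fin[of X] that sub by (cases "X = {}") (auto simp: \<A>_def filter_eq_iff eventually_top)
      then have "Inf C \<noteq> bot" by (rule Inf_filter_not_bot)
      moreover have "Inf C \<le> sequentially"
        using False sub by (metis (no_types, lifting) Inf_lower2 \<A>_def equals0I mem_Collect_eq subsetD)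
      ultimately show ?thesis by (auto simp: \<A>_def Inf_lower)
    qed
  qed
  then obtain U where U: "U \<noteq> bot" "U \<le> sequentially"
    and minimal: "\<And>F. F \<noteq> bot \<Longrightarrow> F \<le> U \<Longrightarrow> F = U"
    unfolding \<A>_def by (smt (verit) dual_order.trans mem_Collect_eq)
  have "eventually P U \<or> eventually (\<lambda>n. \<not> P n) U" for P
  proof (rule disjCI)
    assume "\<not> eventually (\<lambda>n. \<not> P n) U"
    then have "inf U (principal {n. P n}) \<noteq> bot"
      by (simp add: trivial_limit_def eventually_inf_principal)
    then have "inf U (principal {n. P n}) = U"
      by (rule minimal) simp
    then show "eventually P U"
      by (metis (mono_tags, lifting) eventually_inf_principal eventually_mono always_eventually mem_Collect_eq)
  qed
  with U show ?thesis by blast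
qed

definition nat_ultrafilter :: "nat filter" where
  "nat_ultrafilter = (SOME U. U \<noteq> bot \<and> U \<le> sequentially \<and>
     (\<forall>P. eventually P U \<or> eventually (\<lambda>n. \<not> P n) U))"

lemma nat_ultrafilter:
  shows nat_ultrafilter_not_bot: "nat_ultrafilter \<noteq> bot"
    and nat_ultrafilter_le: "nat_ultrafilter \<le> sequentially"
    and nat_ultrafilter_cases: "eventually P nat_ultrafilter \<or> eventually (\<lambda>n. \<not> P n) nat_ultrafilter"
  using someI_ex[OF ex_ultrafilter] unfolding nat_ultrafilter_def[symmetric] by blast+

quotient_type germ = "nat \<Rightarrow> real" / "\<lambda>f g. eventually (\<lambda>n. f n = g n) nat_ultrafilter"
  morphisms rep_germ germ
proof (rule equivpI)
  show "reflp (\<lambda>f g::nat\<Rightarrow>real. eventually (\<lambda>n. f n = g n) nat_ultrafilter)"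
    by (rule reflpI) simp
  show "symp (\<lambda>f g::nat\<Rightarrow>real. eventually (\<lambda>n. f n = g n) nat_ultrafilter)"
    by (rule sympI) (simp add: eq_commute)
  show "transp (\<lambda>f g::nat\<Rightarrow>real. eventually (\<lambda>n. f n = g n) nat_ultrafilter)"
    by (rule transpI) (erule (1) eventually_elim2, simp)
qed

instantiation germ :: field
begin
lift_definition zero_germ :: germ is "\<lambda>n. 0" .
lift_definition one_germ :: germ is "\<lambda>n. 1" .
lift_definition plus_germ :: "germ \<Rightarrow> germ \<Rightarrow> germ" is "\<lambda>f g n. f n + g n"
  by (erule (1) eventually_elim2) simp
lift_definition minus_germ :: "germ \<Rightarrow> germ \<Rightarrow> germ" is "\<lambda>f g n. f n - g n"
  by (erule (1) eventually_elim2) simp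
lift_definition times_germ :: "germ \<Rightarrow> germ \<Rightarrow> germ" is "\<lambda>f g n. f n * g n"
  by (erule (1) eventually_elim2) simp
lift_definition uminus_germ :: "germ \<Rightarrow> germ" is "\<lambda>f n. - f n"
  by (erule eventually_mono) simp
lift_definition inverse_germ :: "germ \<Rightarrow> germ" is "\<lambda>f n. inverse (f n)"
  by (erule eventually_mono) simp
definition divide_germ :: "germ \<Rightarrow> germ \<Rightarrow> germ" where "divide_germ x y = x * inverse y"
instance
proof
  fix a b c :: germ
  show "a + b + c = a + (b + c)" "a * b * c = a * (b * c)" "(a + b) * c = a * c + b * c"
    "a + b = b + a" "a * b = b * a" "0 + a = a" "1 * a = a" "- a + a = 0" "a - b = a + - b"
    by (transfer, simp add: algebra_simps)+
  show "(0::germ) \<noteq> 1"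
    by transfer (simp add: nat_ultrafilter_not_bot)
  show "inverse (0::germ) = 0" by transfer simp
  show "a div b = a * inverse b" by (simp add: divide_germ_def)
  show "inverse a * a = 1" if "a \<noteq> 0"
    using that
  proof transfer
    fix f :: "nat \<Rightarrow> real"
    assume "\<not> eventually (\<lambda>n. f n = 0) nat_ultrafilter"
    then have "eventually (\<lambda>n. f n \<noteq> 0) nat_ultrafilter"
      using nat_ultrafilter_cases[of "\<lambda>n. f n = 0"] by simp
    then show "eventually (\<lambda>n. inverse (f n) * f n = 1) nat_ultrafilter"
      by (rule eventually_mono) simp
  qed
qed
end

lemma germ_0: "germ (\<lambda>n. 0) = 0" and germ_1: "germ (\<lambda>n. 1) = 1"
  and germ_add: "germ (\<lambda>n. f n + g n) = germ f + germ g"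
  and germ_mult: "germ (\<lambda>n. f n * g n) = germ f * germ g"
  and germ_uminus: "germ (\<lambda>n. - f n) = - germ f"
  by (simp_all add: zero_germ.abs_eq one_germ.abs_eq plus_germ.abs_eq times_germ.abs_eq uminus_germ.abs_eq)

lemma germ_sum: "germ (\<lambda>n. \<Sum>i\<in>I. f i n) = (\<Sum>i\<in>I. germ (f i))"
  by (induction I rule: infinite_finite_induct) (simp_all add: germ_0 germ_add)

lemma germ_eq_iff: "germ f = germ g \<longleftrightarrow> eventually (\<lambda>n. f n = g n) nat_ultrafilter"
  by (simp add: germ.abs_eq_iff)

abbreviation const_germ :: "real \<Rightarrow> germ" where
  "const_germ c \<equiv> germ (\<lambda>n. c)"

lemma const_germ_eq_iff: "const_germ a = const_germ b \<longleftrightarrow> a = b"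
  by (simp add: germ_eq_iff nat_ultrafilter_not_bot eventually_const)

instance germ :: field_char_0
proof
  have "of_nat m = const_germ (of_nat m)" for m
    by (induction m) (simp_all add: germ_0 germ_1 germ_add)
  then show "inj (of_nat :: nat \<Rightarrow> germ)"
    by (intro injI) (simp add: const_germ_eq_iff)
qed

lemma poly_germ: "poly (map_poly const_germ q) (germ f) = germ (\<lambda>n. poly q (f n))"
  by (induction q) (simp_all add: map_poly_pCons germ_0 germ_add germ_mult)

lemma map_poly_const_germ_surj:
  assumes "\<And>i. coeff p i \<in> range const_germ"
  shows "\<exists>q. p = map_poly const_germ q"
proof -
  have "const_germ (inv const_germ (coeff p i)) = coeff p i" for i
    by (rule f_inv_into_f[OF assms])
  then have inv_coeff: "const_germ (inv const_germ c) = c" if "c \<in> set (coeffs p)" for c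
    using that by (auto simp: coeffs_def split: if_splits)
  have inj: "inj const_germ" by (rule injI) (simp add: const_germ_eq_iff)
  have "inv const_germ (const_germ 0) = 0" by (rule inv_f_f[OF inj])
  then have "map_poly const_germ (map_poly (inv const_germ) p) = map_poly (\<lambda>x. const_germ (inv const_germ x)) p"
    by (subst map_poly_map_poly) (auto simp: o_def germ_0)
  also have "\<dots> = p"
    by (rule map_poly_idI) (rule inv_coeff)
  finally show ?thesis by metis
qed

text \<open>
  A nonzero real polynomial has finitely many roots, so it vanishes on finitely many terms of an
  injective sequence, and a finite set of indices is negligible because the ultrafilter refines
  \<open>sequentially\<close>.
\<close>

lemma germ_transcendental:
  assumes "inj f" and coeffs: "\<And>i. coeff p i \<in> range const_germ" and root: "poly p (germ f) = 0"
  shows "p = 0"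
proof -
  obtain q where p: "p = map_poly const_germ q" using map_poly_const_germ_surj coeffs by blast
  have ev: "eventually (\<lambda>n. poly q (f n) = 0) nat_ultrafilter"
    using root by (simp add: p poly_germ germ_0[symmetric] germ_eq_iff)
  have "q = 0"
  proof (rule ccontr)
    assume "q \<noteq> 0"
    then have "finite (f -` {x. poly q x = 0})"
      using assms(1) by (intro finite_vimageI poly_roots_finite)
    then have "eventually (\<lambda>n. n \<notin> f -` {x. poly q x = 0}) sequentially"
      by (simp add: eventually_cofinite[symmetric] cofinite_eq_sequentially[symmetric] eventually_cofinite)
    then have "eventually (\<lambda>n. poly q (f n) \<noteq> 0) nat_ultrafilter"
      using nat_ultrafilter_le by (auto simp: le_filter_def)
    with ev have "eventually (\<lambda>n. False) nat_ultrafilter"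
      by (rule eventually_elim2) simp
    then show False using nat_ultrafilter_not_bot by simp
  qed
  then show ?thesis by (simp add: p)
qed

section \<open>Critical values of a quadratic form\<close>

context
  fixes S :: "germ set" and D :: "germ \<Rightarrow> germ"
  assumes der: "subring_derivation S D"
    and const_closed: "\<And>c. const_germ c \<in> S"
    and D_const: "\<And>c. D (const_germ c) = 0"
begin

interpretation subring_derivation S D by (rule der)

lemma derivation_linear_combination:
  assumes "\<And>i. i \<in> I \<Longrightarrow> x i \<in> S"
  shows "(\<Sum>i\<in>I. const_germ (a i) * x i) \<in> S"
    and "D (\<Sum>i\<in>I. const_germ (a i) * x i) = (\<Sum>i\<in>I. const_germ (a i) * D (x i))"
  using assms by (auto intro!: sum_closed mult_closed const_closed sum.cong
      simp: D_sum mult_closed const_closed D_mult D_const)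

text \<open>
  The familiar \<open>D (x \<bullet> L x) = 2 * (D x \<bullet> L x)\<close> for self-adjoint \<open>L\<close>, written in coordinates because
  the derivation acts on germs of coordinates only.
\<close>

lemma derivation_quadratic_form:
  fixes L :: "'a::euclidean_space \<Rightarrow> 'a"
  assumes adj: "\<And>x y. x \<bullet> L y = L x \<bullet> y"
    and coord: "\<And>e. e \<in> Basis \<Longrightarrow> germ (\<lambda>n. X n \<bullet> e) \<in> S"
  shows "D (germ (\<lambda>n. X n \<bullet> L (X n))) =
    (\<Sum>e\<in>Basis. 2 * D (germ (\<lambda>n. X n \<bullet> e)) * germ (\<lambda>n. e \<bullet> L (X n)))"
proof -
  define x where "x e = germ (\<lambda>n. X n \<bullet> e)" for e
  define y where "y e = germ (\<lambda>n. e \<bullet> L (X n))" for e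
  have y: "y e = (\<Sum>c\<in>Basis. const_germ (e \<bullet> L c) * x c)" for e
  proof -
    have "e \<bullet> L v = (\<Sum>c\<in>Basis. (e \<bullet> L c) * (v \<bullet> c))" for v
      unfolding adj euclidean_inner[of "L e" v] by (simp add: adj[symmetric] mult.commute)
    then have "(\<lambda>n. e \<bullet> L (X n)) = (\<lambda>n. \<Sum>c\<in>Basis. (e \<bullet> L c) * (X n \<bullet> c))" by blast
    then have "y e = germ (\<lambda>n. \<Sum>c\<in>Basis. (e \<bullet> L c) * (X n \<bullet> c))"
      unfolding y_def by (rule arg_cong)
    then show ?thesis by (simp only: x_def germ_sum germ_mult)
  qed
  have x_closed: "x e \<in> S" if "e \<in> Basis" for e
    using coord that by (simp add: x_def)
  have y_closed: "y e \<in> S" and D_y: "D (y e) = (\<Sum>c\<in>Basis. const_germ (e \<bullet> L c) * D (x c))" for e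
    unfolding y by (rule derivation_linear_combination, erule x_closed)+
  have "germ (\<lambda>n. X n \<bullet> L (X n)) = (\<Sum>e\<in>Basis. x e * y e)"
    by (subst euclidean_inner) (simp add: germ_sum germ_mult x_def y_def inner_commute)
  then have "D (germ (\<lambda>n. X n \<bullet> L (X n))) = (\<Sum>e\<in>Basis. D (x e) * y e) + (\<Sum>e\<in>Basis. x e * D (y e))"
    by (simp add: D_sum D_mult x_closed y_closed mult_closed sum.distrib)
  also have "(\<Sum>e\<in>Basis. x e * D (y e)) = (\<Sum>c\<in>Basis. \<Sum>e\<in>Basis. x e * (const_germ (e \<bullet> L c) * D (x c)))"
    unfolding D_y sum_distrib_left by (rule sum.swap)
  also have "\<dots> = (\<Sum>c\<in>Basis. D (x c) * y c)"
  proof -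
    have sym: "e \<bullet> L c = c \<bullet> L e" for e c by (metis adj inner_commute)
    have "x e * (const_germ (e \<bullet> L c) * D (x c)) = D (x c) * (const_germ (c \<bullet> L e) * x e)" for e c
      unfolding sym[of e c] by (simp add: mult_ac)
    then show ?thesis unfolding y sum_distrib_left by (intro sum.cong refl)
  qed
  finally show ?thesis
    by (simp add: x_def y_def sum_distrib_left mult.assoc flip: mult_2)
qed

end

lemma subring_derivation_constants: "subring_derivation (range const_germ) (\<lambda>_. 0)"
proof
  show "1 \<in> range const_germ" by (rule range_eqI) (rule germ_1[symmetric])
next
  fix x y assume "x \<in> range const_germ" "y \<in> range const_germ"
  then obtain a b where "x = const_germ a" "y = const_germ b" by blast
  then show "x + y \<in> range const_germ" "x * y \<in> range const_germ"
    by (auto simp only: germ_add[symmetric] germ_mult[symmetric] intro: range_eqI[OF refl])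
next
  fix x assume "x \<in> range const_germ"
  then obtain a where "x = const_germ a" by blast
  then show "- x \<in> range const_germ"
    by (auto simp only: germ_uminus[symmetric] intro: range_eqI[OF refl])
qed simp_all

text \<open>
  A semialgebraic form of Sard's theorem: the equations say that \<open>x\<close> satisfies the Lagrange condition
  for the form \<open>x \<bullet> P x\<close> under the constraints \<open>x \<bullet> L i x = r i\<close>. Along a curve of such
  points the form is constant, since its derivative is a combination of the derivatives of the
  constraints. The proof replaces curves by derivations. Infinitely many values would give a
  sequence with distinct values, that is, a critical point with coordinates in the field of germs
  whose value is transcendental over the reals. Some derivation then sends that value to 1, whereas
  the Lagrange condition forces every derivation that kills the constants to send it to 0.
\<close>

theorem finite_critical_values_of_quadratic_form:
  fixes P :: "'a::euclidean_space \<Rightarrow> 'a" and L :: "'i::finite \<Rightarrow> 'a \<Rightarrow> 'a" and r :: "'i \<Rightarrow> real"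
  assumes P: "\<And>x y. x \<bullet> P y = P x \<bullet> y"
    and L: "\<And>i x y. x \<bullet> L i y = L i x \<bullet> y"
  shows "finite {x \<bullet> P x | x t. P x = (\<Sum>i\<in>UNIV. t i *\<^sub>R L i x) \<and> (\<forall>i. x \<bullet> L i x = r i)}"
    (is "finite ?V")
proof (rule ccontr)
  assume "infinite ?V"
  then obtain v :: "nat \<Rightarrow> real" where v: "inj v" "range v \<subseteq> ?V"
    using infinite_countable_subset by blast
  then have "\<exists>x t. v n = x \<bullet> P x \<and> P x = (\<Sum>i\<in>UNIV. t i *\<^sub>R L i x) \<and> (\<forall>i. x \<bullet> L i x = r i)" for n
    by blast
  then obtain X where "\<And>n. \<exists>t. v n = X n \<bullet> P (X n) \<and> P (X n) = (\<Sum>i\<in>UNIV. t i *\<^sub>R L i (X n)) \<and>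
      (\<forall>i. X n \<bullet> L i (X n) = r i)"
    by (rule that[OF someI_ex])
  then obtain t where Xt: "\<And>n. v n = X n \<bullet> P (X n) \<and> P (X n) = (\<Sum>i\<in>UNIV. t n i *\<^sub>R L i (X n)) \<and>
      (\<forall>i. X n \<bullet> L i (X n) = r i)"
    by (rule that[OF someI_ex])
  then have v_eq: "\<And>n. v n = X n \<bullet> P (X n)"
    and critical: "\<And>n. P (X n) = (\<Sum>i\<in>UNIV. t n i *\<^sub>R L i (X n))"
    and constraint: "\<And>n i. X n \<bullet> L i (X n) = r i"
    by blast+
  interpret constants: subring_derivation "range const_germ" "\<lambda>_. 0"
    by (rule subring_derivation_constants)
  have "constants.transcendental (germ v)"
    unfolding constants.transcendental_def constants.polys_def
    using germ_transcendental[OF v(1)] by blast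
  then obtain S D where SD: "subring_derivation S D" "range const_germ \<subseteq> S" "germ v \<in> S"
      "\<And>a. a \<in> range const_germ \<Longrightarrow> D a = 0" "D (germ v) = 1"
    using constants.extend_derivation[of "germ v"] by blast
  interpret D: subring_derivation S D by fact
  obtain S' D' where SD': "subring_derivation S' D'" "S \<subseteq> S'" "(\<lambda>e. germ (\<lambda>n. X n \<bullet> e)) ` Basis \<subseteq> S'"
      "\<And>a. a \<in> S \<Longrightarrow> D' a = D a"
    using D.extend_derivation_finite[of "(\<lambda>e. germ (\<lambda>n. X n \<bullet> e)) ` Basis"] by auto
  have const: "const_germ c \<in> S'" "D' (const_germ c) = 0" for c
  proof -
    have "const_germ c \<in> S" using SD(2) by blast
    then show "const_germ c \<in> S'" using SD'(2) by blast
    show "D' (const_germ c) = 0"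
      using SD'(4)[OF \<open>const_germ c \<in> S\<close>] SD(4)[of "const_germ c"] by simp
  qed
  define dx where "dx e = D' (germ (\<lambda>n. X n \<bullet> e))" for e
  have quad: "D' (germ (\<lambda>n. X n \<bullet> M (X n))) = (\<Sum>e\<in>Basis. 2 * dx e * germ (\<lambda>n. e \<bullet> M (X n)))"
    if "\<And>x y. x \<bullet> M y = M x \<bullet> y" for M
    unfolding dx_def using SD'(3) by (intro derivation_quadratic_form[OF SD'(1) const that]) auto
  have "D' (germ v) = (\<Sum>e\<in>Basis. 2 * dx e * germ (\<lambda>n. e \<bullet> P (X n)))"
    using quad[OF P] by (simp add: v_eq[abs_def])
  also have "\<dots> = (\<Sum>e\<in>Basis. \<Sum>i\<in>UNIV. 2 * dx e * (germ (\<lambda>n. t n i) * germ (\<lambda>n. e \<bullet> L i (X n))))"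
    by (simp add: critical inner_sum_right germ_sum germ_mult sum_distrib_left)
  also have "\<dots> = (\<Sum>i\<in>UNIV. germ (\<lambda>n. t n i) * (\<Sum>e\<in>Basis. 2 * dx e * germ (\<lambda>n. e \<bullet> L i (X n))))"
    by (subst sum.swap) (simp add: sum_distrib_left mult_ac)
  also have "\<dots> = (\<Sum>i\<in>UNIV. germ (\<lambda>n. t n i) * D' (const_germ (r i)))"
    using quad[OF L] by (simp add: constraint)
  also have "\<dots> = 0"
    by (simp add: const)
  finally show False
    using SD(3,5) SD'(4) by simp
qed

section \<open>Alternating projections between a subspace and a closed set\<close>

lemma proj_norm_le: "w \<in> proj S x \<Longrightarrow> v \<in> S \<Longrightarrow> norm (x - w) \<le> norm (x - v)"
  by (auto simp: proj_def dist_norm intro: order_trans infdist_le)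

lemma proj_subspace_orthogonal:
  fixes A :: "'a::euclidean_space set"
  assumes "subspace A" "w \<in> proj A x" "v \<in> A"
  shows "(x - w) \<bullet> v = 0"
proof -
  have le: "(x - w) \<bullet> (y - w) \<le> 0" if "y \<in> A" for y
    using assms that
    by (intro any_closest_point_dot[of A])
      (auto simp: subspace_imp_convex closed_subspace dist_norm proj_norm_le, simp add: proj_def)
  have "w \<in> A" using assms(2) by (simp add: proj_def)
  then show ?thesis
    using le[of "w + v"] le[of "w - v"] assms by (simp add: subspace_add subspace_diff)
qed

lemma proj_subspace_pythagoras:
  fixes A :: "'a::euclidean_space set"
  assumes "subspace A" "w \<in> proj A x" "v \<in> A"
  shows "(norm (v - x))\<^sup>2 = (norm (v - w))\<^sup>2 + (norm (w - x))\<^sup>2"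
proof -
  have "w \<in> A" using assms(2) by (simp add: proj_def)
  then have "(x - w) \<bullet> (v - w) = 0"
    using assms by (intro proj_subspace_orthogonal[of A]) (auto intro: subspace_diff)
  then have "(v - w) \<bullet> (w - x) = 0" by (simp add: inner_diff inner_commute)
  then show ?thesis
    using norm_add_Pythagorean[of "v - w" "w - x"] by (simp add: orthogonal_def)
qed

lemma closed_graph_proj:
  fixes S :: "'a::euclidean_space set"
  assumes "closed S" "x \<longlonglongrightarrow> x'" "w \<longlonglongrightarrow> w'" "\<And>n. w n \<in> proj S (x n)"
  shows "w' \<in> proj S x'"
proof -
  have "w' \<in> S"
    using closed_sequentially[OF \<open>closed S\<close> _ \<open>w \<longlonglongrightarrow> w'\<close>] assms(4) by (simp add: proj_def)
  moreover have "(\<lambda>n. norm (x n - w n)) \<longlonglongrightarrow> norm (x' - w')"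
    by (intro tendsto_intros assms)
  then have "(\<lambda>n. infdist (x n) S) \<longlonglongrightarrow> norm (x' - w')"
    using assms(4) by (simp add: proj_def)
  then have "norm (x' - w') = infdist x' S"
    by (rule LIMSEQ_unique) (rule tendsto_infdist[OF assms(2)])
  ultimately show ?thesis by (simp add: proj_def)
qed

text \<open>
  The intermediate points in \<open>B\<close> stay bounded, because their distance to \<open>x n\<close> is
  \<open>infdist (x n) B\<close>; a limit of a subsequence of them serves for the limit points.
\<close>

lemma closed_graph_T_AP:
  fixes A B :: "'a::euclidean_space set"
  assumes "closed A" "closed B" and x: "x \<longlonglongrightarrow> x'" and y: "y \<longlonglongrightarrow> y'"
    and xy: "\<And>n. y n \<in> T_AP A B (x n)"
  shows "y' \<in> T_AP A B x'"
proof -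
  have "\<exists>b. b \<in> proj B (x n) \<and> y n \<in> proj A b" for n
    using xy[of n] by (auto simp: T_AP_def)
  then obtain b where b: "\<And>n. b n \<in> proj B (x n)" "\<And>n. y n \<in> proj A (b n)"
    by metis
  have "(\<lambda>n. norm (x n) + infdist (x n) B) \<longlonglongrightarrow> norm x' + infdist x' B"
    by (intro tendsto_intros tendsto_infdist x)
  then have "Bseq (\<lambda>n. norm (x n) + infdist (x n) B)"
    by (intro convergent_imp_Bseq convergentI)
  then obtain K where K: "\<And>n. norm (norm (x n) + infdist (x n) B) \<le> K"
    by (auto simp: Bseq_def)
  have "norm (b n) \<le> K" for n
  proof -
    have "norm (b n) \<le> norm (x n) + norm (x n - b n)" by (metis add.commute diff_add_cancel norm_minus_commute norm_triangle_ineq)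
    also have "\<dots> \<le> K" using K[of n] b(1)[of n] by (simp add: proj_def)
    finally show ?thesis .
  qed
  then have "bounded (range b)" by (auto simp: bounded_iff)
  then obtain b' \<rho> where \<rho>: "strict_mono \<rho>" "(b \<circ> \<rho>) \<longlonglongrightarrow> b'"
    using bounded_imp_convergent_subsequence by blast
  have "b' \<in> proj B x'"
    using closed_graph_proj[OF \<open>closed B\<close> LIMSEQ_subseq_LIMSEQ[OF x \<rho>(1)] \<rho>(2)] b by simp
  moreover have "y' \<in> proj A b'"
    using closed_graph_proj[OF \<open>closed A\<close> \<rho>(2) LIMSEQ_subseq_LIMSEQ[OF y \<rho>(1)]] b by simp
  ultimately show ?thesis by (auto simp: T_AP_def)
qed

lemma closed_Fix_T_AP:
  fixes A B :: "'a::euclidean_space set"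
  assumes "closed A" "closed B"
  shows "closed (Fix (T_AP A B))"
  unfolding closed_sequential_limits Fix_def mem_Collect_eq
  using closed_graph_T_AP[OF assms] by blast

text \<open>
  If \<open>b\<close> is the intermediate point, then \<open>\<bar>x - b\<bar>\<^sup>2 = \<bar>x - y\<bar>\<^sup>2 + \<bar>y - b\<bar>\<^sup>2\<close> because \<open>y\<close> is the orthogonal
  projection of \<open>b\<close> on \<open>A\<close>, and \<open>\<bar>y - b\<bar>\<close> bounds the distance of \<open>y\<close> to \<open>B\<close>.
\<close>

lemma T_AP_step_decrease:
  fixes A B :: "'a::euclidean_space set"
  assumes "subspace A" "x \<in> A" "y \<in> T_AP A B x"
  shows "(norm (x - y))\<^sup>2 \<le> (infdist x B)\<^sup>2 - (infdist y B)\<^sup>2"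
proof -
  obtain b where b: "b \<in> proj B x" "y \<in> proj A b"
    using assms by (auto simp: T_AP_def)
  then have "infdist y B \<le> norm (y - b)"
    by (auto simp: proj_def dist_norm[symmetric] intro: infdist_le)
  then have "(infdist y B)\<^sup>2 \<le> (norm (y - b))\<^sup>2"
    by (simp add: power_mono infdist_nonneg)
  moreover have "(infdist x B)\<^sup>2 = (norm (x - y))\<^sup>2 + (norm (y - b))\<^sup>2"
    using proj_subspace_pythagoras[OF assms(1) b(2) assms(2)] b(1) by (simp add: proj_def)
  ultimately show ?thesis by simp
qed

text \<open>
  The same theorem of Pythagoras, now for a fixed point \<open>p\<close> with intermediate point \<open>b\<close>: the distance
  of \<open>x\<close> to \<open>B\<close> is at most \<open>\<bar>x - b\<bar>\<close>. It bounds the excess of the squared distance over its value at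
  a fixed point by the square of the distance to that fixed point.
\<close>

lemma infdist_le_at_fixed_point:
  fixes A B :: "'a::euclidean_space set"
  assumes "subspace A" "x \<in> A" "p \<in> Fix (T_AP A B)"
  shows "(infdist x B)\<^sup>2 \<le> (infdist p B)\<^sup>2 + (norm (x - p))\<^sup>2"
proof -
  obtain b where b: "b \<in> proj B p" "p \<in> proj A b"
    using assms by (auto simp: T_AP_def Fix_def)
  then have "infdist x B \<le> norm (x - b)"
    by (auto simp: proj_def dist_norm[symmetric] intro: infdist_le)
  then have "(infdist x B)\<^sup>2 \<le> (norm (x - b))\<^sup>2"
    by (simp add: power_mono infdist_nonneg)
  then show ?thesis
    using proj_subspace_pythagoras[OF assms(1) b(2) assms(2)] b(1) by (simp add: proj_def)
qed

lemma geometric_steps_limit: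
  fixes u :: "nat \<Rightarrow> 'a::banach"
  assumes c: "0 < c" "c < 1" and step: "\<And>k. norm (u (Suc k) - u k) \<le> C * c ^ k"
  shows "\<exists>p. u \<longlonglongrightarrow> p \<and> (\<forall>k. norm (u k - p) \<le> C / (1 - c) * c ^ k)"
proof -
  define s where "s k = u (Suc k) - u k" for k
  have geo: "(\<lambda>j. C * c ^ (j + k)) sums (C / (1 - c) * c ^ k)" for k
    using sums_mult[OF geometric_sums[of c], of "C * c ^ k"] c
    by (simp add: power_add mult_ac)
  have "summable s"
    using sums_summable[OF geo[of 0]]
    by (rule summable_comparison_test'[of _ 0]) (simp add: s_def step)
  define p where "p = u 0 + suminf s"
  have telescope: "(\<Sum>j<n. s j) = u n - u 0" for n
    unfolding s_def by (rule sum_lessThan_telescope)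
  have lim: "u \<longlonglongrightarrow> p"
    using tendsto_add[OF tendsto_const[of "u 0"] summable_LIMSEQ[OF \<open>summable s\<close>]]
    by (simp add: telescope p_def)
  have "norm (u k - p) \<le> C / (1 - c) * c ^ k" for k
  proof -
    have "(\<lambda>j. s (j + k)) sums (suminf s - (\<Sum>j<k. s j))"
      by (rule sums_split_initial_segment) (rule summable_sums[OF \<open>summable s\<close>])
    then have tail: "(\<lambda>j. s (j + k)) sums (p - u k)"
      by (simp add: telescope p_def algebra_simps)
    have "norm (\<Sum>j. s (j + k)) \<le> (\<Sum>j. C * c ^ (j + k))"
      by (rule norm_suminf_le[OF _ sums_summable[OF geo]]) (simp add: s_def step del: add_Suc)
    then have "norm (p - u k) \<le> C / (1 - c) * c ^ k"
      using sums_unique[OF tail] sums_unique[OF geo[of k]] by simp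
    then show ?thesis by (simp add: norm_minus_commute)
  qed
  with lim show ?thesis by blast
qed

lemma eventually_contracting_imp_geometric:
  fixes v :: "nat \<Rightarrow> real"
  assumes "0 < c" and v: "\<And>k. 0 \<le> v k" and contr: "\<And>k. k \<ge> K \<Longrightarrow> v (Suc k) \<le> c * v k"
  shows "\<exists>C\<ge>0. \<forall>k. v k \<le> C * c ^ k"
proof -
  define C where "C = (\<Sum>j\<le>K. v j / c ^ j)"
  have le_C: "v k \<le> C * c ^ k" if "k \<le> K" for k
  proof -
    have "v k / c ^ k \<le> C"
      unfolding C_def using that v \<open>0 < c\<close> by (intro member_le_sum) auto
    then show ?thesis using \<open>0 < c\<close> by (simp add: divide_simps)
  qed
  have "v k \<le> C * c ^ k" for k
  proof (induction k)
    case 0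
    show ?case by (rule le_C) simp
  next
    case (Suc k)
    show ?case
    proof (cases "Suc k \<le> K")
      case False
      then have "v (Suc k) \<le> c * v k" by (intro contr) simp
      also have "\<dots> \<le> c * (C * c ^ k)" using Suc \<open>0 < c\<close> by (simp add: mult_left_mono)
      finally show ?thesis by (simp add: mult_ac)
    qed (rule le_C)
  qed
  moreover have "0 \<le> C" unfolding C_def using v \<open>0 < c\<close> by (intro sum_nonneg) simp
  ultimately show ?thesis by blast
qed

text \<open>
  Let \<open>f\<close> be the squared distance to \<open>B\<close> along the sequence, \<open>f'\<close> its limit, \<open>d\<close> the distance to the
  fixed points and \<open>\<Delta>\<close> the step length. Each step lowers \<open>f\<close> by at least \<open>\<Delta>\<^sup>2 \<ge> \<kappa>\<^sup>2 * d\<^sup>2\<close>, so \<open>d\<close> tends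
  to 0, and the values of \<open>f\<close> at nearest fixed points tend to \<open>f'\<close>. As these values form a finite set,
  they are eventually equal to \<open>f'\<close>, which gives \<open>f - f' \<le> d\<^sup>2\<close>. Hence \<open>f - f'\<close> shrinks by the
  factor \<open>1 - \<kappa>\<^sup>2\<close> in each step, and the step lengths decay at least like \<open>c ^ k\<close> whenever
  \<open>1 - \<kappa>\<^sup>2 \<le> c\<^sup>2\<close>. One limit serves for all such \<open>c\<close>.
\<close>

theorem linear_convergence_of_finite_critical_distances:
  fixes A B :: "'a::euclidean_space set"
  defines "T \<equiv> T_AP A B"
  assumes A: "subspace A" and B: "closed B"
    and fin: "finite {infdist p B | p. p \<in> Fix T}" and Fix_ne: "Fix T \<noteq> {}"
    and u: "\<And>k. u k \<in> A" "\<And>k. u (Suc k) \<in> T (u k)"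
    and \<kappa>: "0 < \<kappa>" "\<And>k. \<kappa> * infdist (u k) (Fix T) \<le> norm (u k - u (Suc k))"
  shows "\<exists>p\<in>Fix T. \<forall>c. 0 < c \<and> c < 1 \<and> 1 - \<kappa>\<^sup>2 \<le> c\<^sup>2 \<longrightarrow> converges_linearly u p c"
proof -
  define f where "f k = (infdist (u k) B)\<^sup>2" for k
  define d where "d k = infdist (u k) (Fix T)" for k
  define \<Delta> where "\<Delta> k = norm (u k - u (Suc k))" for k
  have decrease: "(\<Delta> k)\<^sup>2 \<le> f k - f (Suc k)" for k
    using T_AP_step_decrease[OF A u(1)[of k]] u(2)[of k] by (simp add: \<Delta>_def f_def T_def)
  have "decseq f"
    using decrease by (intro decseq_SucI) (smt (verit) zero_le_power2)
  moreover have "0 \<le> f k" for k by (simp add: f_def)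
  ultimately obtain f' where f': "f \<longlonglongrightarrow> f'" "\<And>k. f' \<le> f k"
    using decseq_convergent[of f 0] by metis
  have "0 \<le> f'" using f'(1) by (rule LIMSEQ_le_const) (simp add: f_def)
  define g' where "g' = sqrt f'"
  have "(\<lambda>k. sqrt (f k)) \<longlonglongrightarrow> g'"
    unfolding g'_def by (intro tendsto_intros f')
  then have g_lim: "(\<lambda>k. infdist (u k) B) \<longlonglongrightarrow> g'"
    by (simp add: f_def infdist_nonneg)
  have d\<Delta>: "(\<kappa> * d k)\<^sup>2 \<le> (\<Delta> k)\<^sup>2" for k
    using \<kappa> by (intro power_mono) (auto simp: d_def \<Delta>_def infdist_nonneg)
  have d_lim: "d \<longlonglongrightarrow> 0"
  proof -
    have "(\<lambda>k. f k - f (Suc k)) \<longlonglongrightarrow> f' - f'"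
      by (intro tendsto_diff f' LIMSEQ_Suc)
    then have "(\<lambda>k. (\<kappa> * d k)\<^sup>2) \<longlonglongrightarrow> 0"
      by (intro tendsto_sandwich[of "\<lambda>_. 0" "\<lambda>k. (\<kappa> * d k)\<^sup>2" sequentially "\<lambda>k. f k - f (Suc k)"] always_eventually allI)
        (auto intro: order_trans[OF d\<Delta> decrease])
    then have "(\<lambda>k. sqrt ((\<kappa> * d k)\<^sup>2) / \<kappa>) \<longlonglongrightarrow> sqrt 0 / \<kappa>"
      using \<kappa> by (intro tendsto_intros) auto
    then show ?thesis using \<kappa> by (simp add: d_def[abs_def] infdist_nonneg)
  qed
  obtain \<delta> where \<delta>: "0 < \<delta>" "\<And>p. p \<in> Fix T \<Longrightarrow> infdist p B \<noteq> g' \<Longrightarrow> \<delta> \<le> dist g' (infdist p B)"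
    using finite_set_avoid[OF fin, of g'] by blast
  have "eventually (\<lambda>k. dist (infdist (u k) B) g' < \<delta> / 2 \<and> dist (d k) 0 < \<delta> / 2) sequentially"
    using \<delta> by (intro eventually_conj tendstoD[OF g_lim] tendstoD[OF d_lim]) auto
  then obtain K where K: "\<And>k. k \<ge> K \<Longrightarrow> dist (infdist (u k) B) g' < \<delta> / 2 \<and> dist (d k) 0 < \<delta> / 2"
    by (auto simp: eventually_sequentially)
  define v where "v k = f k - f'" for k
  have v_nonneg: "0 \<le> v k" for k using f' by (simp add: v_def)
  \<comment> \<open>The distance of the nearest fixed point to \<open>B\<close> is less than \<open>\<delta>\<close> away from the limit
    \<open>g'\<close>, hence equal to it.\<close>
  have v_le: "v k \<le> (d k)\<^sup>2" if "k \<ge> K" for k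
  proof -
    have "closed (Fix T)"
      unfolding T_def using A B by (intro closed_Fix_T_AP) (auto intro: closed_subspace)
    then obtain p where p: "p \<in> Fix T" "d k = dist (u k) p"
      using infdist_attains_inf Fix_ne unfolding d_def by metis
    have "\<bar>infdist p B - infdist (u k) B\<bar> \<le> dist (u k) p"
      using infdist_triangle[of p B "u k"] infdist_triangle[of "u k" B p] by (simp add: dist_commute)
    moreover have "\<bar>infdist (u k) B - g'\<bar> < \<delta> / 2" "dist (u k) p < \<delta> / 2"
      using K[OF that] p by (simp_all add: dist_real_def)
    ultimately have "dist g' (infdist p B) < \<delta>"
      unfolding dist_real_def by arith
    then have "infdist p B = g'" using \<delta>(2)[OF p(1)] by force
    then have "f k \<le> f' + (d k)\<^sup>2"
      using infdist_le_at_fixed_point[OF A u(1)[of k], of p B] p \<open>0 \<le> f'\<close>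
      by (simp add: T_def f_def g'_def dist_norm)
    then show ?thesis by (simp add: v_def)
  qed
  have contraction: "v (Suc k) \<le> (1 - \<kappa>\<^sup>2) * v k" if "k \<ge> K" for k
  proof -
    have "\<kappa>\<^sup>2 * v k \<le> \<kappa>\<^sup>2 * (d k)\<^sup>2" by (intro mult_left_mono v_le that) simp
    also have "\<dots> \<le> v k - v (Suc k)"
      using d\<Delta>[of k] decrease[of k] by (simp add: power_mult_distrib v_def)
    finally show ?thesis by (simp add: algebra_simps)
  qed
  have \<Delta>_le: "\<exists>C>0. \<forall>k. \<Delta> k \<le> C * c ^ k" if c: "0 < c" "c < 1" "1 - \<kappa>\<^sup>2 \<le> c\<^sup>2" for c
  proof -
    have "v (Suc k) \<le> c\<^sup>2 * v k" if "k \<ge> K" for k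
      using contraction[OF that] mult_right_mono[OF c(3) v_nonneg[of k]] by linarith
    then obtain C where C: "0 \<le> C" "\<And>k. v k \<le> C * (c\<^sup>2) ^ k"
      using eventually_contracting_imp_geometric[of "c\<^sup>2" v K] c v_nonneg by auto
    have "\<Delta> k \<le> (sqrt C + 1) * c ^ k" for k
    proof -
      have "(\<Delta> k)\<^sup>2 \<le> C * (c\<^sup>2) ^ k"
        using decrease[of k] C(2)[of k] v_nonneg[of "Suc k"] by (simp add: v_def)
      also have "\<dots> = (sqrt C * c ^ k)\<^sup>2"
        using C(1) by (simp add: power_mult_distrib power_mult[symmetric] mult.commute)
      finally have "\<Delta> k \<le> sqrt C * c ^ k"
        using C(1) c by (intro power2_le_imp_le[of "\<Delta> k"]) auto
      also have "\<dots> \<le> (sqrt C + 1) * c ^ k" using c by (simp add: distrib_right)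
      finally show ?thesis .
    qed
    moreover have "0 < sqrt C + 1" using C(1) by (simp add: add_nonneg_pos)
    ultimately show ?thesis by blast
  qed
  have lim: "\<exists>p. u \<longlonglongrightarrow> p \<and> converges_linearly u p c" if c: "0 < c" "c < 1" "1 - \<kappa>\<^sup>2 \<le> c\<^sup>2" for c
  proof -
    obtain C where C: "0 < C" "\<And>k. \<Delta> k \<le> C * c ^ k" using \<Delta>_le[OF c] by blast
    then have "norm (u (Suc k) - u k) \<le> C * c ^ k" for k
      by (simp add: \<Delta>_def norm_minus_commute)
    from geometric_steps_limit[OF c(1,2) this]
    obtain p where "u \<longlonglongrightarrow> p" "\<And>k. norm (u k - p) \<le> C / (1 - c) * c ^ k" by blast
    then show ?thesis
      unfolding converges_linearly_def using c C by (intro exI[of _ p] conjI exI[of _ "C / (1 - c)"]) auto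
  qed
  \<comment> \<open>If \<open>\<kappa> \<ge> 1\<close>, then \<open>1 - \<kappa>\<^sup>2\<close> is not positive; the maximum keeps \<open>c0\<close> in (0,1).\<close>
  define c0 where "c0 = sqrt (max (1 - \<kappa>\<^sup>2) (1 / 2))"
  have "0 < c0" "c0 < 1" "1 - \<kappa>\<^sup>2 \<le> c0\<^sup>2"
    using \<kappa> by (auto simp: c0_def less_max_iff_disj)
  from lim[OF this] obtain p where p: "u \<longlonglongrightarrow> p" by blast
  have "p \<in> T p"
    unfolding T_def
    using closed_graph_T_AP[OF closed_subspace[OF A] B p LIMSEQ_Suc[OF p]] u by (simp add: T_def)
  then have "p \<in> Fix T" by (simp add: Fix_def)
  moreover have "converges_linearly u p c" if "0 < c \<and> c < 1 \<and> 1 - \<kappa>\<^sup>2 \<le> c\<^sup>2" for c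
    using lim[of c] that p LIMSEQ_unique by blast
  ultimately show ?thesis by blast
qed

section \<open>Constraint sets made of spheres\<close>

lemma self_adjoint_linear:
  fixes P :: "'a::real_inner \<Rightarrow> 'a"
  assumes adj: "\<And>x y. x \<bullet> P y = P x \<bullet> y"
  shows "linear P"
proof (rule linearI)
  fix y z :: 'a and c :: real
  have "x \<bullet> P (y + z) = x \<bullet> (P y + P z)" "x \<bullet> P (c *\<^sub>R y) = x \<bullet> (c *\<^sub>R P y)" for x
    by (simp_all add: inner_add_right adj)
  then show "P (y + z) = P y + P z" "P (c *\<^sub>R y) = c *\<^sub>R P y"
    by (metis vector_eq_rdot inner_commute)+
qed

lemma ex_orthogonal_projection:
  fixes A :: "'a::euclidean_space set"
  assumes "subspace A"
  shows "\<exists>P. (\<forall>x y. x \<bullet> P y = P x \<bullet> y) \<and> (\<forall>x. \<forall>w\<in>proj A x. w = P x)"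
proof -
  have "\<exists>y. y \<in> A \<and> (\<forall>w\<in>A. (x - y) \<bullet> w = 0)" for x
  proof -
    obtain y z where "y \<in> span A" "\<And>w. w \<in> span A \<Longrightarrow> orthogonal z w" "x = y + z"
      using orthogonal_subspace_decomp_exists[of A x] by metis
    then show ?thesis
      using assms by (auto simp: span_eq_iff[THEN iffD2] orthogonal_def)
  qed
  then obtain P where P: "\<And>x. P x \<in> A" "\<And>x w. w \<in> A \<Longrightarrow> (x - P x) \<bullet> w = 0" by metis
  have "x \<bullet> P y = P x \<bullet> y" for x y
    using P(2)[OF P(1)[of y], of x] P(2)[OF P(1)[of x], of y]
    by (simp add: inner_diff inner_commute)
  moreover have "w = P x" if w: "w \<in> proj A x" for x w
  proof -
    have "w - P x \<in> A" using w P(1) assms by (auto simp: proj_def intro: subspace_diff)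
    then have "(w - P x) \<bullet> (w - P x) = 0"
      using proj_subspace_orthogonal[OF assms w, of "w - P x"] P(2)[of "w - P x" x]
      by (simp add: inner_diff_left)
    then show ?thesis by simp
  qed
  ultimately show ?thesis by blast
qed

text \<open>
  The orthogonal projections \<open>L i\<close> onto the summands of an orthogonal decomposition of the space. The
  sets \<open>spheres r\<close> below are the products of spheres with squared radii \<open>r i\<close> in the summands; being
  written as \<open>x \<bullet> L i x = r i\<close>, they are intersections of quadrics.
\<close>

locale orthogonal_blocks =
  fixes L :: "'i::finite \<Rightarrow> 'a::euclidean_space \<Rightarrow> 'a"
  assumes adj: "x \<bullet> L i y = L i x \<bullet> y"
    and orth: "L i (L j x) = (if i = j then L i x else 0)"
    and sum_L: "(\<Sum>i\<in>UNIV. L i x) = x"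
begin

lemma linear_L: "linear (L i)"
  by (rule self_adjoint_linear) (rule adj)

lemma inner_L: "x \<bullet> L i y = L i x \<bullet> L i y"
  by (metis adj orth)

lemma inner_L_self: "x \<bullet> L i x = (norm (L i x))\<^sup>2"
  unfolding power2_norm_eq_inner by (rule inner_L)

lemma inner_self_sum: "x \<bullet> x = (\<Sum>i\<in>UNIV. x \<bullet> L i x)"
  using arg_cong[OF sum_L[of x], of "inner x"] by (simp add: inner_sum_right)

definition spheres :: "('i \<Rightarrow> real) \<Rightarrow> 'a set" where
  "spheres r = {x. \<forall>i. x \<bullet> L i x = r i}"

text \<open>
  Moving one block of \<open>b\<close> on its sphere cannot bring it closer to \<open>p\<close>. Comparison with the radial
  projection of \<open>L i p\<close> on that sphere gives equality in the Cauchy-Schwarz inequality for \<open>L i p\<close> and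
  \<open>L i b\<close>. The radius must be positive: a block of \<open>b\<close> that vanishes spans nothing.
\<close>

lemma proj_spheres_parallel_block:
  assumes r: "0 < r i" and b: "b \<in> proj (spheres r) p"
  shows "\<exists>t. L i p = t *\<^sub>R L i b"
proof (cases "L i p = 0")
  case True
  then show ?thesis by (intro exI[of _ 0]) simp
next
  case False
  have bB: "\<And>j. b \<bullet> L j b = r j" using b by (simp add: proj_def spheres_def)
  then have nb: "norm (L i b) = sqrt (r i)"
    using inner_L_self[of b i] by (metis norm_ge_zero real_sqrt_abs abs_of_nonneg)
  define s where "s = sqrt (r i) / norm (L i p)"
  define b' where "b' = b - L i b + s *\<^sub>R L i p"
  have "L j b' = (if j = i then s *\<^sub>R L i p else L j b)" for j
    by (simp add: b'_def linear_add[OF linear_L] linear_diff[OF linear_L] linear_scale[OF linear_L] orth)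
  moreover have "(norm (s *\<^sub>R L i p))\<^sup>2 = r i"
    using False r by (simp add: s_def)
  moreover have "(norm (L j b))\<^sup>2 = r j" for j
    using bB[of j] by (simp add: inner_L_self)
  ultimately have "(norm (L j b'))\<^sup>2 = r j" for j
    by simp
  then have b': "b' \<bullet> L j b' = r j" for j
    by (simp only: inner_L_self)
  then have "norm (p - b) \<le> norm (p - b')"
    using b by (intro proj_norm_le[of b "spheres r"]) (auto simp: spheres_def)
  then have "(p - b) \<bullet> (p - b) \<le> (p - b') \<bullet> (p - b')"
    by (simp add: norm_le)
  moreover have "b \<bullet> b = b' \<bullet> b'"
    by (simp add: inner_self_sum bB b')
  ultimately have "p \<bullet> b' \<le> p \<bullet> b"
    by (simp add: inner_diff inner_commute)
  then have "s * (norm (L i p))\<^sup>2 \<le> L i p \<bullet> L i b"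
    by (simp add: b'_def inner_add_right inner_diff_right inner_L_self inner_L[of p i b])
  moreover have "s * (norm (L i p))\<^sup>2 = norm (L i p) * norm (L i b)"
    using False by (simp add: s_def nb power2_eq_square)
  ultimately have "L i p \<bullet> L i b = norm (L i p) * norm (L i b)"
    using norm_cauchy_schwarz[of "L i p" "L i b"] by linarith
  then have "norm (L i p) *\<^sub>R L i b = norm (L i b) *\<^sub>R L i p"
    by (simp add: norm_cauchy_schwarz_eq)
  moreover have "norm (L i b) > 0" using nb r by simp
  ultimately have "L i p = (norm (L i p) / norm (L i b)) *\<^sub>R L i b"
    by (metis divideR_right divide_inverse_commute less_irrefl scaleR_scaleR)
  then show ?thesis by blast
qed

lemma proj_spheres_multipliers:
  assumes "\<And>i. 0 < r i" and b: "b \<in> proj (spheres r) p"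
  shows "\<exists>t. p = (\<Sum>i\<in>UNIV. t i *\<^sub>R L i b)"
proof -
  obtain t where "\<And>i. L i p = t i *\<^sub>R L i b"
    using proj_spheres_parallel_block[OF assms(1) b] by metis
  then show ?thesis by (metis (no_types, lifting) sum.cong sum_L)
qed

text \<open>
  A fixed point \<open>p\<close> with intermediate point \<open>b\<close> is \<open>P b\<close>, where \<open>P\<close> is the orthogonal projection on
  \<open>A\<close>. As \<open>b\<close> is a nearest point of the spheres, \<open>P b\<close> is a combination of the blocks of \<open>b\<close>, so \<open>b\<close>
  satisfies the Lagrange condition for the form \<open>b \<bullet> P b\<close>. The squared distance of \<open>p\<close> to the spheres
  is a constant minus this critical value.
\<close>

theorem finite_fixed_point_distances:
  assumes A: "subspace A" and r: "\<And>i. 0 < r i"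
  shows "finite {infdist p (spheres r) | p. p \<in> Fix (T_AP A (spheres r))}" (is "finite ?D")
proof -
  obtain P where P: "\<And>x y. x \<bullet> P y = P x \<bullet> y" "\<And>x w. w \<in> proj A x \<Longrightarrow> w = P x"
    using ex_orthogonal_projection[OF A] by blast
  define V where "V = {x \<bullet> P x | x t. P x = (\<Sum>i\<in>UNIV. t i *\<^sub>R L i x) \<and> (\<forall>i. x \<bullet> L i x = r i)}"
  have "finite V"
    unfolding V_def using finite_critical_values_of_quadratic_form[of P L r] P(1) adj by blast
  moreover have "?D \<subseteq> (\<lambda>v. sqrt ((\<Sum>i\<in>UNIV. r i) - v)) ` V"
  proof clarify
    fix p assume "p \<in> Fix (T_AP A (spheres r))"
    then obtain b where b: "b \<in> proj (spheres r) p" "p \<in> proj A b"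
      by (auto simp: Fix_def T_AP_def)
    have p: "p = P b" using P(2) b by blast
    have bB: "\<And>i. b \<bullet> L i b = r i" using b by (simp add: proj_def spheres_def)
    have "b \<bullet> P b \<in> V"
      using proj_spheres_multipliers[OF r b(1)] p bB by (auto simp: V_def)
    moreover have "infdist p (spheres r) = sqrt ((\<Sum>i\<in>UNIV. r i) - b \<bullet> P b)"
    proof -
      have "(b - p) \<bullet> p = 0"
        using b(2) by (intro proj_subspace_orthogonal[OF A]) (auto simp: proj_def)
      then have "(p - b) \<bullet> (p - b) = b \<bullet> b - b \<bullet> p"
        by (simp add: inner_diff inner_commute)
      then have "norm (p - b) = sqrt ((\<Sum>i\<in>UNIV. r i) - b \<bullet> P b)"
        by (simp add: norm_eq_sqrt_inner inner_self_sum bB p)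
      then show ?thesis using b(1) by (simp add: proj_def)
    qed
    ultimately show "infdist p (spheres r) \<in> (\<lambda>v. sqrt ((\<Sum>i\<in>UNIV. r i) - v)) ` V"
      by blast
  qed
  ultimately show ?thesis by (meson finite_imageI finite_subset)
qed

lemma closed_spheres: "closed (spheres r)"
proof -
  have "closed {x. x \<bullet> L i x = r i}" for i
    using linear_continuous_on[of "L i" UNIV] linear_L[of i]
    by (intro closed_Collect_eq continuous_intros) (auto simp: linear_conv_bounded_linear)
  then have "closed (\<Inter>i. {x. x \<bullet> L i x = r i})" by (rule closed_INT[rule_format])
  then show ?thesis by (simp add: spheres_def Collect_all_eq)
qed

end

section \<open>The discrete Fourier transform is unitary\<close>

lemma bij_betw_pos: "bij_betw (pos :: 'n::{finite,linorder} \<Rightarrow> nat) UNIV {..<CARD('n)}"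
proof -
  have less: "pos i < pos j" if "i < j" for i j :: 'n
    unfolding pos_def by (rule psubset_card_mono) (use that in auto)
  have inj: "inj (pos :: 'n \<Rightarrow> nat)"
    by (rule injI) (metis less less_irrefl linorder_less_linear)
  have "pos i < CARD('n)" for i :: 'n
    unfolding pos_def by (rule psubset_card_mono) auto
  then have "range (pos :: 'n \<Rightarrow> nat) = {..<CARD('n)}"
    by (intro card_subset_eq) (auto simp: card_image[OF inj])
  with inj show ?thesis by (simp add: bij_betw_def)
qed

definition dft_root :: "'n::{finite,linorder} \<Rightarrow> complex" where
  "dft_root i = exp (- (2 * of_real pi * \<i> * of_nat (pos i) / of_nat CARD('n)))"

lemma cmod_dft_root: "cmod (dft_root i) = 1"
  by (simp add: dft_root_def norm_exp_eq_Re)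

lemma dft_root_power_card: "dft_root (i :: 'n::{finite,linorder}) ^ CARD('n) = 1"
proof -
  have "dft_root i ^ CARD('n) = exp (- (2 * of_real pi * \<i> * of_nat (pos i)))"
    unfolding dft_root_def by (subst exp_of_nat_mult[symmetric]) simp
  also have "\<dots> = 1"
    by (metis exp_minus exp_two_pi_i inverse_1 mult.assoc mult.commute exp_of_nat_mult power_one)
  finally show ?thesis .
qed

lemma inj_dft_root: "inj (dft_root :: 'n::{finite,linorder} \<Rightarrow> complex)"
proof (rule injI)
  fix i j :: 'n
  assume "dft_root i = dft_root j"
  then have "exp (2 * of_real pi * \<i> * of_nat (pos i) / of_nat CARD('n)) =
      exp (2 * of_real pi * \<i> * of_nat (pos j) / of_nat CARD('n))"
    by (simp add: dft_root_def exp_minus)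
  then have "pos i mod CARD('n) = pos j mod CARD('n)"
    by (subst (asm) complex_root_unity_eq) (auto simp: Suc_le_eq)
  moreover have "pos i < CARD('n)" "pos j < CARD('n)"
    using bij_betw_apply[OF bij_betw_pos[where 'n = 'n]] by force+
  ultimately show "i = j"
    using bij_betw_imp_inj_on[OF bij_betw_pos[where 'n = 'n]] by (simp add: inj_eq)
qed

text \<open>
  A geometric sum over the powers of a root of unity of order dividing \<open>CARD('n)\<close>, which is 1 only
  for \<open>i = j\<close> because distinct positions have distinct roots.
\<close>

lemma dft_root_orthogonal:
  fixes i j :: "'n::{finite,linorder}"
  shows "(\<Sum>p::'n\<in>UNIV. dft_root i ^ pos p * cnj (dft_root j ^ pos p)) = (if i = j then of_nat CARD('n) else 0)"
proof -
  define z where "z = dft_root i * cnj (dft_root j)"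
  have inv: "cnj (dft_root j) = inverse (dft_root j)" for j :: 'n
    using complex_norm_square[of "dft_root j"] by (intro inverse_unique[symmetric]) (simp add: cmod_dft_root)
  have nz: "dft_root j \<noteq> 0" for j :: 'n by (simp add: dft_root_def)
  have "z ^ CARD('n) = 1"
    by (simp add: z_def power_mult_distrib dft_root_power_card flip: complex_cnj_power)
  moreover have "z = 1 \<longleftrightarrow> i = j"
    using inj_eq[OF inj_dft_root, of i j] nz by (auto simp: z_def inv field_simps)
  moreover have "(\<Sum>p::'n\<in>UNIV. dft_root i ^ pos p * cnj (dft_root j ^ pos p)) = (\<Sum>k<CARD('n). z ^ k)"
    using sum.reindex_bij_betw[OF bij_betw_pos, of "\<lambda>k. z ^ k"]
    by (simp add: z_def power_mult_distrib)
  ultimately show ?thesis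
    by (auto simp: geometric_sum)
qed

lemma dft_parseval_1d:
  fixes v :: "'n::{finite,linorder} \<Rightarrow> complex"
  shows "(\<Sum>p::'n\<in>UNIV. (cmod (\<Sum>i\<in>UNIV. v i * dft_root i ^ pos p))\<^sup>2) = of_nat CARD('n) * (\<Sum>i\<in>UNIV. (cmod (v i))\<^sup>2)"
proof -
  have "complex_of_real (\<Sum>p::'n\<in>UNIV. (cmod (\<Sum>i\<in>UNIV. v i * dft_root i ^ pos p))\<^sup>2) =
      (\<Sum>p::'n\<in>UNIV. (\<Sum>i\<in>UNIV. v i * dft_root i ^ pos p) * (\<Sum>j\<in>UNIV. cnj (v j) * cnj (dft_root j ^ pos p)))"
    by (simp only: of_real_sum complex_norm_square cnj_sum complex_cnj_mult)
  also have "\<dots> = (\<Sum>p::'n\<in>UNIV. \<Sum>i\<in>UNIV. \<Sum>j\<in>UNIV. v i * cnj (v j) * (dft_root i ^ pos p * cnj (dft_root j ^ pos p)))"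
    by (simp add: sum_product mult_ac del: complex_cnj_power)
  also have "\<dots> = (\<Sum>i\<in>UNIV. \<Sum>j\<in>UNIV. \<Sum>p::'n\<in>UNIV. v i * cnj (v j) * (dft_root i ^ pos p * cnj (dft_root j ^ pos p)))"
    by (rule trans[OF sum.swap]) (intro sum.cong refl sum.swap)
  also have "\<dots> = (\<Sum>i\<in>UNIV. \<Sum>j\<in>UNIV. v i * cnj (v j) * (if i = j then of_nat CARD('n) else 0))"
    by (simp only: sum_distrib_left[symmetric] dft_root_orthogonal)
  also have "\<dots> = (\<Sum>i\<in>UNIV. of_nat CARD('n) * (v i * cnj (v i)))"
    by (simp add: if_distrib sum.delta mult_ac cong: if_cong)
  also have "\<dots> = complex_of_real (of_nat CARD('n) * (\<Sum>i\<in>UNIV. (cmod (v i))\<^sup>2))"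
    by (simp only: sum_distrib_left of_real_sum of_real_mult complex_norm_square of_real_of_nat_eq)
  finally show ?thesis by (simp only: of_real_eq_iff)
qed

lemma norm_carray: "(norm (w :: 'n::finite carray))\<^sup>2 = (\<Sum>i\<in>UNIV. \<Sum>j\<in>UNIV. (cmod (w $ i $ j))\<^sup>2)"
  by (simp add: norm_vec_def L2_set_def sum_nonneg)

text \<open>
  The two-dimensional transform as two one-dimensional ones, the inner one in the second index.
\<close>

lemma dft2_eq: "dft2 (w :: 'n::{finite,linorder} carray) $ p $ q =
  (1 / of_nat CARD('n)) * (\<Sum>i\<in>UNIV. (\<Sum>j\<in>UNIV. w $ i $ j * dft_root j ^ pos q) * dft_root i ^ pos p)"
proof -
  have "exp (- (2 * of_real pi * \<i> * of_nat (pos i * pos p + pos j * pos q) / of_nat CARD('n))) =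
      dft_root j ^ pos q * dft_root i ^ pos p" for i j :: 'n
    unfolding dft_root_def exp_of_nat_mult[symmetric] exp_add[symmetric]
    by (rule arg_cong[where f = exp]) (simp add: field_simps)
  then show ?thesis by (simp add: dft2_def sum_distrib_right mult.assoc)
qed

lemma norm_dft2: "norm (dft2 (w :: 'n::{finite,linorder} carray)) = norm w"
proof -
  let ?N = "real CARD('n)"
  define y where "y i q = (\<Sum>j\<in>UNIV. w $ i $ j * dft_root j ^ pos q)" for i q :: 'n
  have "(norm (dft2 w))\<^sup>2 = (\<Sum>p::'n\<in>UNIV. \<Sum>q\<in>UNIV. (cmod (\<Sum>i\<in>UNIV. y i q * dft_root i ^ pos p))\<^sup>2 / ?N\<^sup>2)"
    by (simp add: norm_carray dft2_eq y_def norm_mult norm_divide power_mult_distrib power_divide)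
  also have "\<dots> = (\<Sum>q\<in>UNIV. (\<Sum>p::'n\<in>UNIV. (cmod (\<Sum>i\<in>UNIV. y i q * dft_root i ^ pos p))\<^sup>2) / ?N\<^sup>2)"
    by (subst sum.swap) (simp add: sum_divide_distrib)
  also have "\<dots> = (\<Sum>q\<in>UNIV. \<Sum>i\<in>UNIV. (cmod (y i q))\<^sup>2 / ?N)"
    unfolding dft_parseval_1d by (simp add: power2_eq_square[of "?N"] sum_divide_distrib)
  also have "\<dots> = (\<Sum>i\<in>UNIV. (\<Sum>q\<in>UNIV. (cmod (y i q))\<^sup>2) / ?N)"
    by (subst sum.swap) (simp add: sum_divide_distrib)
  also have "\<dots> = (norm w)\<^sup>2"
    unfolding y_def dft_parseval_1d by (simp add: norm_carray)
  finally show ?thesis by (simp add: power2_eq_iff_nonneg)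
qed

lemma linear_dft2: "linear (dft2 :: 'n::{finite,linorder} carray \<Rightarrow> _)"
  by (rule linearI; simp add: vec_eq_iff dft2_eq)
    (simp_all add: algebra_simps add_divide_distrib sum.distrib sum_distrib_left scaleR_sum_right scaleR_conv_of_real)

section \<open>The sets of the phase retrieval problem\<close>

definition Mmap_all :: "('m::finite \<Rightarrow> 'n::{finite,linorder} rarray) \<Rightarrow> ('n, 'm) hprod \<Rightarrow> ('n, 'm) hprod" where
  "Mmap_all \<phi> x = (\<chi> d. Mmap (\<phi> d) (x $ d))"

lemma linear_Mmap_all:
  fixes \<phi> :: "'m::finite \<Rightarrow> 'n::{finite,linorder} rarray"
  shows "linear (Mmap_all \<phi>)"
proof -
  have "dft2 (\<chi> i j. (x + y) $ i $ j * z i j) = dft2 (\<chi> i j. x $ i $ j * z i j) + dft2 (\<chi> i j. y $ i $ j * z i j)"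
    "dft2 (\<chi> i j. (c *\<^sub>R x) $ i $ j * z i j) = c *\<^sub>R dft2 (\<chi> i j. x $ i $ j * z i j)"
    for x y :: "'n carray" and z c
    unfolding linear_add[OF linear_dft2, symmetric] linear_scale[OF linear_dft2, symmetric]
    by (rule arg_cong[where f = dft2], simp add: vec_eq_iff algebra_simps)+
  then show ?thesis
    by (intro linearI) (simp_all add: vec_eq_iff Mmap_all_def Mmap_def)
qed

lemma norm_Mmap_all:
  fixes \<phi> :: "'m::finite \<Rightarrow> 'n::{finite,linorder} rarray"
  shows "norm (Mmap_all \<phi> x) = norm x"
proof -
  have "norm (dft2 (\<chi> i j. w $ i $ j * exp (\<i> * of_real (\<theta> $ i $ j)))) = norm w" for w :: "'n carray" and \<theta>
    unfolding norm_dft2 by (simp add: norm_vec_def L2_set_def norm_mult)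
  then show ?thesis
    by (simp add: Mmap_all_def Mmap_def norm_vec_def[where 'b = 'm] norm_vec_def[where 'b = comp])
qed

lemma orthogonal_Mmap_all: "orthogonal_transformation (Mmap_all \<phi>)"
  unfolding orthogonal_transformation by (simp add: linear_Mmap_all norm_Mmap_all)

text \<open>
  The six components at one pixel of one of the \<open>m\<close> images form one block, and an intensity
  prescribes the norm of this block. \<open>pixel\<close> is the projection on a block after the transforms have
  been applied, \<open>pixel_block\<close> is its pullback under the unitary map \<open>Mmap_all\<close>.
\<close>

definition pixel :: "'m::finite \<times> 'n::finite \<times> 'n \<Rightarrow> ('n, 'm) hprod \<Rightarrow> ('n, 'm) hprod" where
  "pixel k y = (\<chi> d c i j. if k = (d, i, j) then y $ d $ c $ i $ j else 0)"

definition pixel_block ::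
    "('m::finite \<Rightarrow> 'n::{finite,linorder} rarray) \<Rightarrow> 'm \<times> 'n \<times> 'n \<Rightarrow> ('n, 'm) hprod \<Rightarrow> ('n, 'm) hprod" where
  "pixel_block \<phi> k x = inv (Mmap_all \<phi>) (pixel k (Mmap_all \<phi> x))"

lemma Mmap_all_pixel_block: "Mmap_all \<phi> (pixel_block \<phi> k x) = pixel k (Mmap_all \<phi> x)"
  unfolding pixel_block_def
  by (rule surj_f_inv_f[OF orthogonal_transformation_surj[OF orthogonal_Mmap_all]])

lemma inner_pixel_block: "x \<bullet> pixel_block \<phi> k y = Mmap_all \<phi> x \<bullet> pixel k (Mmap_all \<phi> y)"
  using orthogonal_Mmap_all[of \<phi>] unfolding orthogonal_transformation_def
  by (metis Mmap_all_pixel_block)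

lemma orthogonal_blocks_pixel_block:
  fixes \<phi> :: "'m::finite \<Rightarrow> 'n::{finite,linorder} rarray"
  shows "orthogonal_blocks (pixel_block \<phi>)"
proof
  fix k l and x y :: "('n, 'm) hprod"
  note inj = injD[OF orthogonal_transformation_inj[OF orthogonal_Mmap_all[of \<phi>]]]
  show "x \<bullet> pixel_block \<phi> k y = pixel_block \<phi> k x \<bullet> y"
    unfolding inner_pixel_block inner_commute[of "pixel_block \<phi> k x"]
    by (auto simp: pixel_def inner_vec_def inner_commute intro!: sum.cong)
  show "pixel_block \<phi> k (pixel_block \<phi> l x) = (if k = l then pixel_block \<phi> k x else 0)"
    by (rule inj) (auto simp: Mmap_all_pixel_block linear_0[OF linear_Mmap_all] pixel_def vec_eq_iff)
  have "(\<Sum>k\<in>UNIV. pixel k y) = y" for y :: "('n, 'm) hprod"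
    by (simp add: vec_eq_iff pixel_def)
  then have "Mmap_all \<phi> (\<Sum>k\<in>UNIV. pixel_block \<phi> k x) = Mmap_all \<phi> x"
    by (simp add: linear_sum[OF linear_Mmap_all] Mmap_all_pixel_block)
  then show "(\<Sum>k\<in>UNIV. pixel_block \<phi> k x) = x" by (rule inj)
qed

text \<open>
  Removes the innermost of nested sums whose summand is supported at one tuple of indices; the
  remaining equations are collected in \<open>P\<close>.
\<close>

lemma sum_if_conj_eq:
  "(\<Sum>x::'a::finite\<in>UNIV. if P \<and> a = x then f x else 0) = (if P then f a else 0)"
  by (cases P) auto

lemma setB_eq_spheres:
  fixes \<phi> r :: "'m::finite \<Rightarrow> 'n::{finite,linorder} rarray"
  shows "setB \<phi> r = orthogonal_blocks.spheres (pixel_block \<phi>) (\<lambda>(d, i, j). r d $ i $ j)"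
proof -
  have "x \<bullet> pixel_block \<phi> (d, i, j) x = (\<Sum>c\<in>UNIV. (cmod (Mmap (\<phi> d) (x $ d) $ c $ i $ j))\<^sup>2)" 
    for x :: "('n, 'm) hprod" and d i j
  proof -
    let ?y = "Mmap_all \<phi> x"
    have "x \<bullet> pixel_block \<phi> (d, i, j) x =
        (\<Sum>d'\<in>UNIV. \<Sum>c\<in>UNIV. \<Sum>i'\<in>UNIV. \<Sum>j'\<in>UNIV.
           if ((True \<and> d = d') \<and> i = i') \<and> j = j' then (cmod (?y $ d' $ c $ i' $ j'))\<^sup>2 else 0)"
      unfolding inner_pixel_block
      by (auto simp: pixel_def inner_vec_def power2_norm_eq_inner intro!: sum.cong)
    also have "\<dots> = (\<Sum>c\<in>UNIV. (cmod (?y $ d $ c $ i $ j))\<^sup>2)"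
      by (simp only: sum_if_conj_eq sum.swap[of _ "UNIV :: comp set"] if_True)
    finally show ?thesis by (simp add: Mmap_all_def)
  qed
  then show ?thesis
    by (auto simp: setB_def Omega_def orthogonal_blocks.spheres_def[OF orthogonal_blocks_pixel_block])
qed

lemma subspace_setA:
  fixes kX kY kZ :: "'n::{finite,linorder} rarray"
  shows "subspace (setA kX kY kZ :: ('n, 'm::finite) hprod set)"
proof -
  define emb :: "'n carray \<Rightarrow> ('n, 'm) hprod"
    where "emb x = (\<chi> d c i j. of_real (Emat kX kY kZ c $ i $ j) * x $ i $ j)" for x
  have "linear emb"
    by (rule linearI) (simp_all add: emb_def vec_eq_iff algebra_simps)
  then have "subspace (range emb)"
    by (intro linear_subspace_image) auto
  moreover have "range emb = setA kX kY kZ"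
    by (auto simp: setA_def Omega0_def emb_def)
  ultimately show ?thesis by simp
qed

section \<open>Linear convergence\<close>

theorem theorem6p8:
  fixes kX kY kZ :: "'n::{finite,linorder} rarray"
    and \<phi> r :: "'m::finite \<Rightarrow> 'n rarray"
    and A B U :: "('n, 'm) hprod set"
    and T :: "('n, 'm) hprod \<Rightarrow> ('n, 'm) hprod set"
    and a b :: "('n, 'm) hprod"
    and \<epsilon> \<kappa> :: real
  assumes unit_k: "\<And>i j. (kX $ i $ j)\<^sup>2 + (kY $ i $ j)\<^sup>2 + (kZ $ i $ j)\<^sup>2 = 1"
    and kZ: "\<And>i j. 1 + kZ $ i $ j \<noteq> 0"
    and r_nonneg: "\<And>d i j. 0 \<le> r d $ i $ j"
  defines "A \<equiv> setA kX kY kZ"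
    and "B \<equiv> setB \<phi> r"
    and "T \<equiv> T_AP A B"
  assumes "a \<in> A" and "a \<in> Fix T"
    and "proj B a = {b}"
    and "\<And>d i j. Gmap (\<phi> d) (b $ d) $ i $ j \<noteq> 0"
    and "0 < \<epsilon>"
    and nbhd: "b \<in> interior U"
    and "almost_averaged T U \<epsilon> (2/3)"
    and "a \<in> U"
    and "(\<Union>u \<in> A \<inter> U. T u) \<subseteq> U"
    and "metrically_subregular (id_minus T) U 0 A \<kappa>"
    and "sqrt (2 * \<epsilon>) < \<kappa>"
  shows "sqrt (1 + \<epsilon> - \<kappa>\<^sup>2 / 2) < 1 \<and>
    (\<forall>u. u 0 \<in> A \<inter> U \<and> (\<forall>k. u (Suc k) \<in> T (u k)) \<longrightarrow>
      (\<exists>p \<in> Fix T. converges_linearly_at_most u p (sqrt (1 + \<epsilon> - \<kappa>\<^sup>2 / 2))))"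
proof -
  interpret orthogonal_blocks "pixel_block \<phi>" by (rule orthogonal_blocks_pixel_block)
  define \<rho> where "\<rho> = (\<lambda>(d, i, j). r d $ i $ j)"
  have A: "subspace A" unfolding A_def by (rule subspace_setA)
  have B_eq: "B = spheres \<rho>" unfolding B_def \<rho>_def by (rule setB_eq_spheres)
  then have B: "closed B" by (simp add: closed_spheres)
  have "b \<in> B" using \<open>proj B a = {b}\<close> by (auto simp: proj_def)
  \<comment> \<open>The spheres are nondegenerate: their radii are the entries of the arrays \<open>Gmap\<close> at \<open>b\<close>.\<close>
  have "0 < \<rho> k" for k
  proof (cases k)
    case (fields d i j)
    have "r d $ i $ j = (Gmap (\<phi> d) (b $ d) $ i $ j)\<^sup>2"
      using \<open>b \<in> B\<close> by (simp add: B_def setB_def Omega_def Gmap_def r_nonneg)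
    then show ?thesis
      using assms(10) fields by (simp add: \<rho>_def)
  qed
  then have fin: "finite {infdist p B | p. p \<in> Fix T}"
    unfolding T_def B_eq by (intro finite_fixed_point_distances A)
  have "0 < \<kappa>"
    using \<open>sqrt (2 * \<epsilon>) < \<kappa>\<close> \<open>0 < \<epsilon>\<close> by (meson less_trans mult_pos_pos real_sqrt_gt_zero zero_less_numeral)
  then have "2 * \<epsilon> < \<kappa>\<^sup>2"
    using \<open>sqrt (2 * \<epsilon>) < \<kappa>\<close> by (metis real_less_lsqrt real_sqrt_less_iff real_sqrt_abs abs_of_pos)
  then have rate: "sqrt (1 + \<epsilon> - \<kappa>\<^sup>2 / 2) < 1" by simp
  have T_A: "T x \<subseteq> A" for x by (auto simp: T_def T_AP_def proj_def)
  \<comment> \<open>\<open>T\<close> takes values in \<open>A\<close>, so the zeros of \<open>Id - T\<close> relative to \<open>A\<close> are all fixed points.\<close>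
  have zeros: "{v. 0 \<in> id_minus T v} \<inter> A = Fix T"
    using T_A by (auto simp: id_minus_def Fix_def)
  have "\<exists>p \<in> Fix T. converges_linearly_at_most u p (sqrt (1 + \<epsilon> - \<kappa>\<^sup>2 / 2))"
    if "u 0 \<in> A \<inter> U" and u: "\<And>k. u (Suc k) \<in> T (u k)" for u
  proof -
    have in_AU: "u k \<in> A \<inter> U" for k
    proof (induction k)
      case (Suc k)
      then show ?case using u[of k] T_A assms(15) by blast
    qed (rule that)
    have "\<kappa> * infdist (u k) (Fix T) \<le> norm (u k - u (Suc k))" for k
    proof -
      have "\<kappa> * infdist (u k) (Fix T) \<le> infdist 0 (id_minus T (u k))"
        using \<open>metrically_subregular (id_minus T) U 0 A \<kappa>\<close> in_AU[of k]
        by (auto simp: metrically_subregular_def zeros)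
      also have "\<dots> \<le> dist 0 (u k - u (Suc k))"
        using u[of k] by (intro infdist_le) (auto simp: id_minus_def)
      finally show ?thesis by simp
    qed
    then obtain p where p: "p \<in> Fix T"
        "\<And>c. 0 < c \<and> c < 1 \<and> 1 - \<kappa>\<^sup>2 \<le> c\<^sup>2 \<Longrightarrow> converges_linearly u p c"
      using linear_convergence_of_finite_critical_distances[OF A B, of u \<kappa>]
        fin u in_AU \<open>0 < \<kappa>\<close> \<open>a \<in> Fix T\<close> unfolding T_def by blast
    have "converges_linearly_at_most u p (sqrt (1 + \<epsilon> - \<kappa>\<^sup>2 / 2))"
      \<comment> \<open>The guaranteed factor \<open>1 - \<kappa>\<^sup>2\<close> never exceeds \<open>1 + \<epsilon> - \<kappa>\<^sup>2 / 2\<close>. If the latter is not positive,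
        then neither is the former, and every number in (0,1) is a rate.\<close>
    proof (cases "0 < 1 + \<epsilon> - \<kappa>\<^sup>2 / 2")
      case True
      then show ?thesis
        unfolding converges_linearly_at_most_def using rate \<open>0 < \<epsilon>\<close>
        by (auto intro!: p(2) add_nonneg_nonneg)
    next
      case False
      have "1 - \<kappa>\<^sup>2 \<le> c\<^sup>2" for c
        using False \<open>0 < \<epsilon>\<close> zero_le_power2[of c] by linarith
      then show ?thesis
        unfolding converges_linearly_at_most_def using False by (auto intro!: p(2))
    qed
    with p(1) show ?thesis by blast
  qed
  with rate show ?thesis by blast
qed

end
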